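(* Assume (A'), (S') and (H'). Let $\mathcal{A}^b$ be the strictly stationary, measurable random $\mathcal{D}^b$-attractor of the stochastic flow $S(t,s;\omega)x$ associated to $dX_t=A(X_t)dt+dN_t$, and write $\mathcal{A}(\omega):=\mathcal{A}^b(0,\omega)$. Then $\mathcal{A}^b$ consists of a single random fixed point, i.e. $\mathbb{P}$-a.s. $$\mathcal{A}(\omega)=\{\eta(\omega)\}\quad\text{and}\quad\varphi(t,\omega)\eta(\omega)=\eta(\theta_t\omega),\ t\ge0.$$
   Context: Setting. $V\subseteq H\equiv H^*\subseteq V^*$ is a Gelfand triple: $H$ is a separable Hilbert space identified with its dual, $V$ is a reflexive Banach space continuously and densely embedded into $H$, and ${}_{V^*}\langle\cdot,\cdot\rangle_V$ is the duality pairing. $(\Omega,\mathcal{F},\{\mathcal{F}_t\}_{t\in\mathbb{R}},\mathbb{P})$ is a filtered probability space and $(\Omega,\mathcal{F},\mathbb{P},\{\theta_t\}_{t\in\mathbb{R}})$ is a metric dynamical system: $(t,\omega)\mapsto\theta_t\omega$ is $(\mathcal{B}(\mathbb{R})\otimes\mathcal{F},\mathcal{F})$-measurable, $\theta_0=\mathrm{id}$, $\theta_{t+s}=\theta_t\circ\theta_s$, and each $\theta_t$ preserves $\mathbb{P}$. (A') $A:V\to V^*$ is measurable, independent of $(t,\omega)$ (and extended by $0$ to all of $H$), and there are $\alpha\in(1,2)$ and positive constants $f,c,C_2$ such that: - for all $v,v_1,v_2\in V$ the map $s\mapsto{}_{V^*}\langle A(v_1+sv_2),v\rangle_V$ is continuous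 on $\mathbb{R}$; - $2\,{}_{V^*}\langle A(v_1)-A(v_2),v_1-v_2\rangle_V\le C_2\|v_1-v_2\|_H^2$ for $v_1,v_2\in V$; - $2\,{}_{V^*}\langle A(v),v\rangle_V\le-c\|v\|_V^\alpha+f$ for $v\in V$; - $\|A(v)\|_{V^*}^{\frac{\alpha}{\alpha-1}}\le C_2\|v\|_V^\alpha+f$ for $v\in V$; - the embedding $V\subseteq H$ is compact; - there exist $c'>0$ and $\delta\in(0,\alpha)$ with $2\,{}_{V^*}\langle A(v_1)-A(v_2),v_1-v_2\rangle_V\le-c'\frac{\|v_1-v_2\|_H^2}{\|v_1\|_V^\delta+\|v_2\|_V^\delta}$ for all $v_1,v_2\in V$. (S') $N_t=W_t$ is a $V$-valued ($\mathcal{F}_t$-adapted, two-sided) Wiener process, realized on the metric dynamical system so that $N_t(\omega)-N_s(\omega)=N_{t-s}(\theta_s\omega)-N_0(\theta_s\omega)$ for all $s,t,\omega$, that all paths are càdlàg in $V$, and that there is a set of full measure on which $\|N_t(\omega)\|_V=o(|t|^{\frac1{2-\alpha}})$ as $t\to-\infty$. Flow. For $s\in\mathbb{R}$, $\omega\in\Omega$, $x\in H$, $Z(\cdot,s;\omega)x\in L^\alpha_{loc}([s,\infty);V)\cap C([s,\infty);H)$ is the unique solution of $Z(t,s;\omega)x=x+\int_s^tA(Z(r,s;\omega)x+N_r(\omega))\,dr$, $t\ge s$ (in $V^*$); $S(t,s;\omega)x:=Z(t,s;\omega)(x-N_s(\omega))+N_t(\omega)$ and $\varphi(t,\omega):=S(t,0;\omega)$,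 which is a continuous RDS, with $S(t,s;\omega)=\varphi(t-s,\theta_s\omega)$. (H') There is a closed convex cone $H_+\subseteq H$ with $H_+\cap(-H_+)=\{0\}$, inducing the partial order $x\le y$ iff $y-x\in H_+$, and a dense subset $S_0\subseteq H$ such that $\varphi(t,\omega)x\le\varphi(t,\omega)y$ for all $x\le y$ in $S_0$, $t\ge0$, $\omega\in\Omega$, and for all $x,y\in S_0$ there is $z\in S_0$ with $x,y\le z$. Attractor. $\mathcal{D}^b$ is the system of all deterministic bounded sets (families $D(t,\omega)\equiv B$, $B\subseteq H$ bounded). With $d(B_1,B_2):=\sup_{b_1\in B_1}\inf_{b_2\in B_2}\|b_1-b_2\|_H$, a family $F$ is $\mathcal{D}^b$-attracting if on a set $\Omega_0$ of full measure $d(S(t,s;\omega)D(s,\omega),F(t,\omega))\to0$ as $s\to-\infty$ for all $D\in\mathcal{D}^b$, $t\in\mathbb{R}$. A family $\{\mathcal{A}(t,\omega)\}$ of subsets of $H$ is a random $\mathcal{D}^b$-attractor if $\mathbb{P}$-a.s.: $\mathcal{A}(t,\omega)$ is nonempty and compact for each $t$; $\mathcal{A}$ is $\mathcal{D}^b$-attracting; $S(t,s;\omega)\mathcal{A}(s,\omega)=\mathcal{A}(t,\omega)$ for all $s\le t$. Strictly stationary: $\mathcal{A}(t,\omega)=\mathcal{A}(0,\theta_t\omega)$. Measurable: $\mathbb{P}$-a.s. closed and $\omega\mapsto d(x,\mathcal{A}(t,\omega))$ measurable for all $x\in H,t\in\mathbb{R}$. Under the present assumptions such a strictly stationary, measurable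 random $\mathcal{D}^b$-attractor $\mathcal{A}^b$ exists; it is given ($\mathbb{P}$-a.s.) by $\mathcal{A}^b(t,\omega)=\overline{\bigcup_{D\in\mathcal{D}^b}\Omega(D,t;\omega)}$, where $\Omega(D,t;\omega):=\bigcap_{r<t}\overline{\bigcup_{\tau<r}S(t,\tau;\omega)D(\tau,\omega)}$. *)

theory Defs
  imports "HOL-Probability.Probability" "HOL-Library.Landau_Symbols"
begin

section \<open>Gelfand triples\<close>

text \<open>
  The space \<open>H\<close> is the type \<open>'h\<close>, the space \<open>V\<close> is the type \<open>'v\<close> together with its embedding
  \<open>\<iota> :: 'v \<Rightarrow> 'h\<close>, and the dual of \<open>V\<close> is the type \<open>'v \<Rightarrow>\<^sub>L real\<close>; the duality pairing is
  \<open>blinfun_apply\<close>. The sort \<open>second_countable_topology\<close> expresses separability. For \<open>'v\<close> it is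
  no restriction: \<open>V\<close> is reflexive and densely embedded, so the image of the separable space \<open>H\<close>
  is dense in the dual of \<open>V\<close>; that dual is then separable, and hence so is \<open>V\<close>.
\<close>

definition reflexive_space :: "'v::banach itself \<Rightarrow> bool" where
  "reflexive_space _ \<longleftrightarrow>
     (\<forall>\<xi> :: ('v \<Rightarrow>\<^sub>L real) \<Rightarrow>\<^sub>L real. \<exists>v. \<forall>l. blinfun_apply \<xi> l = blinfun_apply l v)"

definition gelfand_triple ::
  "('v::{banach, second_countable_topology}
     \<Rightarrow> 'h::{real_inner, banach, second_countable_topology}) \<Rightarrow> bool" where
  "gelfand_triple \<iota> \<longleftrightarrow>
     reflexive_space TYPE('v) \<and> bounded_linear \<iota> \<and> inj \<iota> \<and> closure (range \<iota>) = UNIV"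

text \<open>The embedding of \<open>H\<close> (identified with its dual) into the dual of \<open>V\<close>.\<close>

definition to_dual ::
  "('v::banach \<Rightarrow> 'h::{real_inner, banach}) \<Rightarrow> 'h \<Rightarrow> ('v \<Rightarrow>\<^sub>L real)" where
  "to_dual \<iota> h = Blinfun (\<lambda>v. h \<bullet> \<iota> v)"

definition extend_zero ::
  "('v::banach \<Rightarrow> 'h::{real_inner, banach}) \<Rightarrow> ('v \<Rightarrow> ('v \<Rightarrow>\<^sub>L real)) \<Rightarrow> 'h \<Rightarrow> ('v \<Rightarrow>\<^sub>L real)"
where
  "extend_zero \<iota> A h = (if h \<in> range \<iota> then A (inv \<iota> h) else 0)"


section \<open>The assumptions on the drift\<close>

text \<open>
  In the last condition the quotient is \<open>0 / 0 = 0\<close> for \<open>v1 = v2 = 0\<close>, where the left-hand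
  side vanishes as well.
\<close>

definition drift_condition ::
  "('v::{banach, second_countable_topology}
     \<Rightarrow> 'h::{real_inner, banach, second_countable_topology})
   \<Rightarrow> ('v \<Rightarrow> ('v \<Rightarrow>\<^sub>L real)) \<Rightarrow> real \<Rightarrow> real \<Rightarrow> real \<Rightarrow> real \<Rightarrow> bool" where
  "drift_condition \<iota> A \<alpha> f c C2 \<longleftrightarrow>
     A \<in> borel_measurable borel \<and> 1 < \<alpha> \<and> \<alpha> < 2 \<and> 0 < f \<and> 0 < c \<and> 0 < C2 \<and>
     (\<forall>v v1 v2. continuous_on UNIV (\<lambda>s::real. blinfun_apply (A (v1 + s *\<^sub>R v2)) v)) \<and>
     (\<forall>v1 v2. 2 * blinfun_apply (A v1 - A v2) (v1 - v2) \<le> C2 * (norm (\<iota> v1 - \<iota> v2))\<^sup>2) \<and>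
     (\<forall>v. 2 * blinfun_apply (A v) v \<le> - c * norm v powr \<alpha> + f) \<and>
     (\<forall>v. norm (A v) powr (\<alpha> / (\<alpha> - 1)) \<le> C2 * norm v powr \<alpha> + f) \<and>
     (\<forall>B. bounded B \<longrightarrow> compact (closure (\<iota> ` B))) \<and>
     (\<exists>c' \<delta>. 0 < c' \<and> 0 < \<delta> \<and> \<delta> < \<alpha> \<and>
        (\<forall>v1 v2. 2 * blinfun_apply (A v1 - A v2) (v1 - v2)
           \<le> - c' * ((norm (\<iota> v1 - \<iota> v2))\<^sup>2 / (norm v1 powr \<delta> + norm v2 powr \<delta>))))"


section \<open>The noise\<close>

definition metric_dynamical_system :: "'w measure \<Rightarrow> (real \<Rightarrow> 'w \<Rightarrow> 'w) \<Rightarrow> bool" where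
  "metric_dynamical_system M \<theta> \<longleftrightarrow>
     prob_space M \<and>
     (\<lambda>(t, \<omega>). \<theta> t \<omega>) \<in> measurable (borel \<Otimes>\<^sub>M M) M \<and>
     (\<forall>\<omega>\<in>space M. \<theta> 0 \<omega> = \<omega>) \<and>
     (\<forall>t s. \<forall>\<omega>\<in>space M. \<theta> (t + s) \<omega> = \<theta> t (\<theta> s \<omega>)) \<and>
     (\<forall>t. distr M M (\<theta> t) = M)"

definition filtered_space :: "'w measure \<Rightarrow> (real \<Rightarrow> 'w measure) \<Rightarrow> bool" where
  "filtered_space M F \<longleftrightarrow> filtration (space M) F \<and> (\<forall>t. sets (F t) \<subseteq> sets M)"

definition centred_gaussian :: "real \<Rightarrow> real measure" where
  "centred_gaussian q =
     (if q = 0 then return borel 0 else density lborel (normal_density 0 (sqrt q)))"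

text \<open>
  A two-sided Wiener process with values in a separable Banach space. The increments are Gaussian
  with covariance proportional to the length of the time interval; \<open>q l\<close> is the quadratic form of
  the covariance at the functional \<open>l\<close>, and may be degenerate.

  Adaptedness to the filtration is stated separately. Independence of increments is meant among
  disjoint time intervals and not relative to the sigma-algebras of the filtration: a process
  indexed by all of the reals that is adapted to \<open>F\<close>, and whose increments on \<open>[s,t]\<close> are
  independent of \<open>F s\<close> for every \<open>s\<close>, has only degenerate Gaussian increments.
\<close>

definition two_sided_wiener ::
  "'w measure \<Rightarrow> (real \<Rightarrow> 'w \<Rightarrow> 'v::{banach, second_countable_topology}) \<Rightarrow> bool" where
  "two_sided_wiener M W \<longleftrightarrow>
     (\<forall>t. W t \<in> borel_measurable M) \<and>
     (AE \<omega> in M. W 0 \<omega> = 0) \<and>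
     (AE \<omega> in M. continuous_on UNIV (\<lambda>t. W t \<omega>)) \<and>
     (\<forall>n \<tau>. (\<forall>i<n. \<tau> i \<le> \<tau> (Suc i)) \<longrightarrow>
        prob_space.indep_vars M (\<lambda>_. borel) (\<lambda>i \<omega>. W (\<tau> (Suc i)) \<omega> - W (\<tau> i) \<omega>) {..<n::nat}) \<and>
     (\<exists>q :: ('v \<Rightarrow>\<^sub>L real) \<Rightarrow> real. (\<forall>l. 0 \<le> q l) \<and>
        (\<forall>s t l. s \<le> t \<longrightarrow>
           distr M borel (\<lambda>\<omega>. blinfun_apply l (W t \<omega> - W s \<omega>)) = centred_gaussian ((t - s) * q l)))"

definition cadlag :: "(real \<Rightarrow> 'v::topological_space) \<Rightarrow> bool" where
  "cadlag g \<longleftrightarrow> (\<forall>t. (g \<longlongrightarrow> g t) (at_right t) \<and> (\<exists>l. (g \<longlongrightarrow> l) (at_left t)))"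

definition noise_condition ::
  "'w measure \<Rightarrow> (real \<Rightarrow> 'w measure) \<Rightarrow> (real \<Rightarrow> 'w \<Rightarrow> 'w) \<Rightarrow> real
   \<Rightarrow> (real \<Rightarrow> 'w \<Rightarrow> 'v::{banach, second_countable_topology}) \<Rightarrow> bool" where
  "noise_condition M F \<theta> \<alpha> N \<longleftrightarrow>
     two_sided_wiener M N \<and>
     (\<forall>t. N t \<in> borel_measurable (F t)) \<and>
     (\<forall>s t. \<forall>\<omega>\<in>space M. N t \<omega> - N s \<omega> = N (t - s) (\<theta> s \<omega>) - N 0 (\<theta> s \<omega>)) \<and>
     (\<forall>\<omega>\<in>space M. cadlag (\<lambda>t. N t \<omega>)) \<and>
     (AE \<omega> in M. (\<lambda>t. norm (N t \<omega>)) \<in> o[at_bot](\<lambda>t. \<bar>t\<bar> powr (1 / (2 - \<alpha>))))"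


section \<open>The stochastic flow\<close>

text \<open>
  Local \<open>p\<close>-integrability on \<open>[s,\<infinity>)\<close> of a \<open>V\<close>-valued function. The function is given with values
  in \<open>H\<close> and need only take values in \<open>V\<close> at almost every time.
\<close>

definition Lp_loc_from ::
  "('v::{banach, second_countable_topology}
     \<Rightarrow> 'h::{real_inner, banach, second_countable_topology}) \<Rightarrow> real \<Rightarrow> real \<Rightarrow> (real \<Rightarrow> 'h) \<Rightarrow> bool"
where
  "Lp_loc_from \<iota> p s u \<longleftrightarrow>
     (\<exists>z. z \<in> borel_measurable lborel \<and>
          (AE r in lborel. s \<le> r \<longrightarrow> u r = \<iota> (z r)) \<and>
          (\<forall>t\<ge>s. set_integrable lborel {s..t} (\<lambda>r. norm (z r) powr p)))"

text \<open>
  \<open>is_solution \<iota> A \<alpha> n s x u\<close>: \<open>u\<close> solves \<open>u t = x + \<integral>\<^sub>s\<^sup>t A (u r + n r) dr\<close>, \<open>t \<ge> s\<close>, for a fixed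
  noise path \<open>n\<close>. The equation holds in the dual of \<open>V\<close>. The integral is the library's gauge
  integral there, since the Bochner integral requires a type of sort
  \<open>second_countable_topology\<close>. Under the growth bound on \<open>A\<close> the integrand is Bochner
  integrable for every \<open>u\<close> in the class required below and a cadlag \<open>n\<close>, and the two integrals
  agree.
\<close>

definition is_solution ::
  "('v::{banach, second_countable_topology}
     \<Rightarrow> 'h::{real_inner, banach, second_countable_topology})
   \<Rightarrow> ('v \<Rightarrow> ('v \<Rightarrow>\<^sub>L real)) \<Rightarrow> real \<Rightarrow> (real \<Rightarrow> 'v) \<Rightarrow> real \<Rightarrow> 'h \<Rightarrow> (real \<Rightarrow> 'h) \<Rightarrow> bool" where
  "is_solution \<iota> A \<alpha> n s x u \<longleftrightarrow>
     Lp_loc_from \<iota> \<alpha> s u \<and> continuous_on {s..} u \<and>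
     (\<forall>t\<ge>s. ((\<lambda>r. extend_zero \<iota> A (u r + \<iota> (n r))) has_integral
              (to_dual \<iota> (u t) - to_dual \<iota> x)) {s..t})"

definition solution_flow ::
  "'w measure \<Rightarrow> ('v::{banach, second_countable_topology}
     \<Rightarrow> 'h::{real_inner, banach, second_countable_topology})
   \<Rightarrow> ('v \<Rightarrow> ('v \<Rightarrow>\<^sub>L real)) \<Rightarrow> real \<Rightarrow> (real \<Rightarrow> 'w \<Rightarrow> 'v)
   \<Rightarrow> (real \<Rightarrow> real \<Rightarrow> 'w \<Rightarrow> 'h \<Rightarrow> 'h) \<Rightarrow> bool" where
  "solution_flow M \<iota> A \<alpha> N Z \<longleftrightarrow>
     (\<forall>s. \<forall>\<omega>\<in>space M. \<forall>x.
        is_solution \<iota> A \<alpha> (\<lambda>r. N r \<omega>) s x (\<lambda>t. Z t s \<omega> x) \<and>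
        (\<forall>u. is_solution \<iota> A \<alpha> (\<lambda>r. N r \<omega>) s x u \<longrightarrow> (\<forall>t\<ge>s. u t = Z t s \<omega> x)))"

definition stochastic_flow ::
  "('v \<Rightarrow> 'h::ab_group_add) \<Rightarrow> (real \<Rightarrow> 'w \<Rightarrow> 'v) \<Rightarrow> (real \<Rightarrow> real \<Rightarrow> 'w \<Rightarrow> 'h \<Rightarrow> 'h)
   \<Rightarrow> real \<Rightarrow> real \<Rightarrow> 'w \<Rightarrow> 'h \<Rightarrow> 'h" where
  "stochastic_flow \<iota> N Z t s \<omega> x = Z t s \<omega> (x - \<iota> (N s \<omega>)) + \<iota> (N t \<omega>)"

definition cocycle_of :: "(real \<Rightarrow> real \<Rightarrow> 'w \<Rightarrow> 'h \<Rightarrow> 'h) \<Rightarrow> real \<Rightarrow> 'w \<Rightarrow> 'h \<Rightarrow> 'h" where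
  "cocycle_of S t \<omega> = S t 0 \<omega>"


section \<open>Monotonicity\<close>

definition cone_le :: "'h::ab_group_add set \<Rightarrow> 'h \<Rightarrow> 'h \<Rightarrow> bool" where
  "cone_le Hp x y \<longleftrightarrow> y - x \<in> Hp"

definition order_condition ::
  "'w measure \<Rightarrow> (real \<Rightarrow> 'w \<Rightarrow> 'h::{real_inner, banach} \<Rightarrow> 'h) \<Rightarrow> 'h set \<Rightarrow> 'h set \<Rightarrow> bool" where
  "order_condition M \<phi> Hp S0 \<longleftrightarrow>
     closed Hp \<and> convex_cone Hp \<and> Hp \<inter> uminus ` Hp = {0} \<and>
     closure S0 = UNIV \<and>
     (\<forall>x\<in>S0. \<forall>y\<in>S0. cone_le Hp x y \<longrightarrow>
        (\<forall>t\<ge>0. \<forall>\<omega>\<in>space M. cone_le Hp (\<phi> t \<omega> x) (\<phi> t \<omega> y))) \<and>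
     (\<forall>x\<in>S0. \<forall>y\<in>S0. \<exists>z\<in>S0. cone_le Hp x z \<and> cone_le Hp y z)"


section \<open>Random attractors\<close>

text \<open>Values in \<^typ>\<open>ennreal\<close>, so that the infimum over the empty set is infinite.\<close>

definition semidist :: "'h::real_normed_vector set \<Rightarrow> 'h set \<Rightarrow> ennreal" where
  "semidist B1 B2 = (SUP b1\<in>B1. INF b2\<in>B2. ennreal (norm (b1 - b2)))"

definition bounded_families :: "(real \<Rightarrow> 'w \<Rightarrow> 'h::real_normed_vector set) set" where
  "bounded_families = {D. \<exists>B. bounded B \<and> D = (\<lambda>t \<omega>. B)}"

definition attracting ::
  "'w measure \<Rightarrow> (real \<Rightarrow> 'w \<Rightarrow> 'h::real_normed_vector set) set
   \<Rightarrow> (real \<Rightarrow> real \<Rightarrow> 'w \<Rightarrow> 'h \<Rightarrow> 'h) \<Rightarrow> (real \<Rightarrow> 'w \<Rightarrow> 'h set) \<Rightarrow> bool" where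
  "attracting M \<D> S K \<longleftrightarrow>
     (AE \<omega> in M. \<forall>D\<in>\<D>. \<forall>t. ((\<lambda>s. semidist (S t s \<omega> ` D s \<omega>) (K t \<omega>)) \<longlongrightarrow> 0) at_bot)"

definition random_attractor ::
  "'w measure \<Rightarrow> (real \<Rightarrow> 'w \<Rightarrow> 'h::real_normed_vector set) set
   \<Rightarrow> (real \<Rightarrow> real \<Rightarrow> 'w \<Rightarrow> 'h \<Rightarrow> 'h) \<Rightarrow> (real \<Rightarrow> 'w \<Rightarrow> 'h set) \<Rightarrow> bool" where
  "random_attractor M \<D> S K \<longleftrightarrow>
     (AE \<omega> in M. \<forall>t. K t \<omega> \<noteq> {} \<and> compact (K t \<omega>)) \<and>
     attracting M \<D> S K \<and>
     (AE \<omega> in M. \<forall>s t. s \<le> t \<longrightarrow> S t s \<omega> ` K s \<omega> = K t \<omega>)"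

definition strictly_stationary ::
  "'w measure \<Rightarrow> (real \<Rightarrow> 'w \<Rightarrow> 'w) \<Rightarrow> (real \<Rightarrow> 'w \<Rightarrow> 'h set) \<Rightarrow> bool" where
  "strictly_stationary M \<theta> K \<longleftrightarrow> (\<forall>t. \<forall>\<omega>\<in>space M. K t \<omega> = K 0 (\<theta> t \<omega>))"

definition measurable_family ::
  "'w measure \<Rightarrow> (real \<Rightarrow> 'w \<Rightarrow> 'h::real_normed_vector set) \<Rightarrow> bool" where
  "measurable_family M K \<longleftrightarrow>
     (AE \<omega> in M. \<forall>t. closed (K t \<omega>)) \<and>
     (\<forall>x t. (\<lambda>\<omega>. semidist {x} (K t \<omega>)) \<in> borel_measurable M)"

end

theory Submission
  imports Defs
begin

text \<open>
  The theorem rests on two facts. First, for a fixed noise path the flow strictly decreases the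
  distance of any two distinct points of \<open>H\<close> (\<open>solutions_strictly_contract\<close>). Secondly, the
  attractor is a stationary family of compact sets. By invariance, \<open>A(\<omega>)\<close> is the image of
  \<open>A(\<theta>\<^sub>-\<^sub>1 \<omega>)\<close> under the flow from time \<open>-1\<close> to time \<open>0\<close>, so its diameter is at most that of
  \<open>A(\<theta>\<^sub>-\<^sub>1 \<omega>)\<close>. Both diameters have the same law, because \<open>\<theta>\<^sub>-\<^sub>1\<close> preserves the probability measure,
  and two ordered random variables with the same law agree almost surely. But if the diameter of
  \<open>A(\<omega>)\<close> is positive, it is attained at two points, whose preimages in \<open>A(\<theta>\<^sub>-\<^sub>1 \<omega>)\<close> are strictly
  farther apart. Hence the diameter vanishes almost surely, and invariance of the attractor turns
  its only point into a random fixed point.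

  The strict contraction follows from strict monotonicity of the drift once the energy inequality
  \<open>|w(t)|\<^sup>2 - |w(s)|\<^sup>2 \<le> 2 \<integral>\<^sub>s\<^sup>t \<langle>w', w\<rangle> dr\<close> is known for the difference \<open>w\<close> of two solutions. Here \<open>w'\<close> lives in
  the dual of \<open>V\<close>, while \<open>w\<close> lies in \<open>V\<close> only at almost every time. The
  starting point is the elementary inequality \<open>|w(b)|\<^sup>2 - |w(a)|\<^sup>2 \<le> 2 (w(b) - w(a), w(b))\<close>; when \<open>w(b)\<close>
  comes from \<open>V\<close>, its right-hand side is an integral over \<open>[a,b]\<close> with the test vector \<open>w(b)\<close>
  frozen. Dividing by \<open>b - a\<close> and letting \<open>a\<close> tend to \<open>b\<close> bounds the left difference quotients of
  \<open>|w|\<^sup>2\<close> at almost every \<open>b\<close>, by Lebesgue's differentiation theorem. An almost everywhere bound on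
  derivatives controls increments only together with some domination, and Young's inequality
  supplies it: the quotients stay below a running average of one integrable function plus the value
  at \<open>b\<close> of another. Fatou's lemma then integrates the pointwise bound
  (\<open>increment_le_integral_of_left_derivative_bound\<close>).
\<close>

section \<open>Integrating bounds on left difference quotients\<close>

text \<open>
  Lebesgue's differentiation theorem for averages to the left, obtained from the one for averages
  to the right by the reflection \<open>x \<mapsto> -x\<close>. Left averages are needed because the energy estimate
  below evaluates the test vector at the right endpoint of the interval.
\<close>

lemma AE_left_average_tendsto:
  fixes f :: "real \<Rightarrow> real"
  assumes "\<And>a b. f integrable_on {a..b}"
  shows "AE b in lborel. ((\<lambda>h. integral {b - h..b} f / h) \<longlongrightarrow> f b) (at_right 0)"
proof -
  define g where "g = (\<lambda>x. f (- x))"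
  have refl: "integral {x..x + h} g = integral {- x - h..- x} f" for x h
    using Henstock_Kurzweil_Integration.integral_reflect_real[where a = "- x - h" and b = "- x" and f = f]
    by (simp add: g_def add.commute)
  have "g integrable_on cbox a b" for a b
    using assms[of "- b" "- a"]
      Henstock_Kurzweil_Integration.integrable_reflect_real[where f = f and a = "- b" and b = "- a"]
    by (simp add: g_def)
  then obtain N where N: "negligible N"
    and lim: "\<And>x e. \<lbrakk>x \<notin> N; 0 < e\<rbrakk> \<Longrightarrow> \<exists>d>0. \<forall>h. 0 < h \<and> h < d \<longrightarrow>
                norm (integral (cbox x (x + h *\<^sub>R One)) g /\<^sub>R h ^ DIM(real) - g x) < e"
    using integrable_ccontinuous_explicit[of g] by blast
  have *: "((\<lambda>h. integral {b - h..b} f / h) \<longlongrightarrow> f b) (at_right 0)" if b: "- b \<notin> N" for b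
  proof (rule tendstoI)
    fix e :: real assume "0 < e"
    from lim[OF b this] obtain d where "d > 0"
      and d: "\<And>h. 0 < h \<Longrightarrow> h < d \<Longrightarrow>
        norm (integral (cbox (- b) (- b + h *\<^sub>R One)) g /\<^sub>R h ^ DIM(real) - g (- b)) < e"
      by blast
    then have "dist (integral {b - h..b} f / h) (f b) < e" if "0 < h" "h < d" for h
      using d[OF that] refl[of "- b" h] by (simp add: dist_real_def g_def divide_inverse mult.commute)
    then show "\<forall>\<^sub>F h in at_right 0. dist (integral {b - h..b} f / h) (f b) < e"
      using \<open>d > 0\<close> by (auto simp: eventually_at_right_field)
  qed
  have "negligible (uminus ` N)"
    using N by (intro negligible_differentiable_image_negligible) (auto intro!: derivative_intros)
  moreover have "{b. \<not> ((\<lambda>h. integral {b - h..b} f / h) \<longlongrightarrow> f b) (at_right 0)} \<subseteq> uminus ` N"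
    using * by force
  ultimately have "AE b in lebesgue. ((\<lambda>h. integral {b - h..b} f / h) \<longlongrightarrow> f b) (at_right 0)"
    unfolding eventually_ae_filter_negligible by blast
  then show ?thesis by (rule iffD1[OF AE_completion_iff])
qed

lemma integral_le_nn_integral:
  fixes f :: "'a \<Rightarrow> real"
  assumes "integrable M f"
  shows "ennreal (integral\<^sup>L M f) \<le> (\<integral>\<^sup>+x. ennreal (f x) \<partial>M)"
proof -
  have "integral\<^sup>L M f \<le> (\<integral>x. max 0 (f x) \<partial>M)"
    using assms by (intro integral_mono) auto
  moreover have "(\<integral>\<^sup>+x. ennreal (max 0 (f x)) \<partial>M) = ennreal (\<integral>x. max 0 (f x) \<partial>M)"
    using assms by (intro nn_integral_eq_integral) auto
  ultimately show ?thesis by (simp add: ennreal_leI ennreal_max_0)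
qed

lemma left_average_tendsto:
  fixes \<Phi> :: "real \<Rightarrow> real"
  assumes "continuous_on UNIV \<Phi>"
  shows "((\<lambda>h. integral {t - h..t} \<Phi> / h) \<longlongrightarrow> \<Phi> t) (at_right 0)"
proof -
  define K where "K x = integral {t - 1..x} \<Phi>" for x
  have int: "\<Phi> integrable_on {a..b}" for a b
    using assms by (auto intro!: integrable_continuous_real intro: continuous_on_subset)
  have "(K has_real_derivative \<Phi> t) (at t within {t - 1..t + 1})"
    unfolding K_def[abs_def]
    by (rule integral_has_real_derivative) (auto intro: continuous_on_subset[OF assms])
  then have "(K has_real_derivative \<Phi> t) (at t)"
    by (simp add: at_within_Icc_at)
  then have "((\<lambda>y. (K (t + y) - K t) / y) \<longlongrightarrow> \<Phi> t) (at 0)"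
    by (simp add: DERIV_def)
  moreover have "filterlim uminus (at (0::real)) (at_right 0)"
    by (auto simp: filterlim_at eventually_at_right_field intro!: tendsto_eq_intros exI[of _ 1])
  ultimately have lim: "((\<lambda>h. (K (t + - h) - K t) / - h) \<longlongrightarrow> \<Phi> t) (at_right 0)"
    by (rule filterlim_compose)
  have "\<forall>\<^sub>F h in at_right 0. (K (t + - h) - K t) / - h = integral {t - h..t} \<Phi> / h"
  proof -
    have "integral {t - h..t} \<Phi> = K t - K (t - h)" if "0 < h" "h < 1" for h
      using Henstock_Kurzweil_Integration.integral_combine[of "t - 1" "t - h" t \<Phi>] int that
      by (simp add: K_def)
    then have "(K (t + - h) - K t) / - h = integral {t - h..t} \<Phi> / h" if "0 < h" "h < 1" for h
      using that by (simp add: minus_divide_left flip: minus_divide_right)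
    then show ?thesis by (auto simp: eventually_at_right_field intro!: exI[of _ 1])
  qed
  with lim show ?thesis by (rule Lim_transform_eventually)
qed

text \<open>Telescoping: the integrals of \<open>\<Phi>\<close> and of its shift cancel except near the two endpoints.\<close>

lemma has_integral_left_difference_quotient:
  fixes \<Phi> :: "real \<Rightarrow> real"
  assumes cont: "continuous_on UNIV \<Phi>" and "s \<le> t" "0 < h"
  shows "((\<lambda>b. (\<Phi> b - \<Phi> (b - h)) / h) has_integral
           integral {t - h..t} \<Phi> / h - integral {s - h..s} \<Phi> / h) {s..t}"
proof -
  have int: "\<Phi> integrable_on {a..b}" for a b
    using assms by (auto intro!: integrable_continuous_real intro: continuous_on_subset)
  have "(\<Phi> has_integral integral {s - h..t - h} \<Phi>) (cbox (s - h) (t - h))"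
    using int by (simp add: integrable_integral)
  from has_integral_affinity[OF this, of 1 "- h"]
  have shift: "((\<lambda>b. \<Phi> (b - h)) has_integral integral {s - h..t - h} \<Phi>) {s..t}"
    using \<open>s \<le> t\<close> by (simp add: image_affinity_atLeastAtMost add.commute)
  have "((\<lambda>b. (\<Phi> b - \<Phi> (b - h)) / h) has_integral
          (integral {s..t} \<Phi> - integral {s - h..t - h} \<Phi>) / h) {s..t}"
    by (intro has_integral_divide has_integral_diff shift integrable_integral int)
  moreover have "integral {s..t} \<Phi> - integral {s - h..t - h} \<Phi>
      = integral {t - h..t} \<Phi> - integral {s - h..s} \<Phi>"
    using Henstock_Kurzweil_Integration.integral_combine[of "s - h" s t \<Phi>]
      Henstock_Kurzweil_Integration.integral_combine[of "s - h" "t - h" t \<Phi>] int assms by simp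
  ultimately show ?thesis by (simp add: diff_divide_distrib)
qed

text \<open>
  A bound on the left derivative that holds only almost everywhere says nothing about increments
  (the Cantor function has derivative zero almost everywhere). What excludes such behaviour is the
  integrable majorant \<open>\<kappa>\<close> of all difference quotients ending at \<open>b\<close>: Fatou's lemma, applied to \<open>\<kappa>\<close>
  minus the quotients, bounds the integrals of the quotients in the limit by the integral of \<open>q\<close>,
  and these integrals converge to the increment of \<open>\<Phi>\<close> by telescoping.
\<close>

lemma increment_le_integral_of_left_derivative_bound:
  fixes \<Phi> \<kappa> q :: "real \<Rightarrow> real"
  assumes cont: "continuous_on UNIV \<Phi>" and "a < s" "s \<le> t"
    and \<kappa>: "set_integrable lborel {s..t} \<kappa>" and q: "set_integrable lborel {s..t} q"
    and bound: "AE b in lborel. b \<in> {s..t} \<longrightarrow> (\<forall>r. a \<le> r \<and> r < b \<longrightarrow> \<Phi> b - \<Phi> r \<le> (b - r) * \<kappa> b)"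
    and limsup: "AE b in lborel. b \<in> {s..t} \<longrightarrow>
      (\<forall>e>0. \<forall>\<^sub>F h in at_right 0. (\<Phi> b - \<Phi> (b - h)) / h \<le> q b + e)"
  shows "\<Phi> t - \<Phi> s \<le> set_lebesgue_integral lborel {s..t} q"
proof -
  \<comment> \<open>Step sizes strictly below \<open>s - a\<close>, so that the quotients at points of \<open>[s,t]\<close> stay inside \<open>[a,t]\<close>.\<close>
  define h where "h n = (s - a) / (2 + real n)" for n
  define u where "u n b = indicator {s..t} b * (\<kappa> b - (\<Phi> b - \<Phi> (b - h n)) / h n)" for n b
  define I where "I n = (LINT b|lborel. indicator {s..t} b * \<kappa> b)
                         - (integral {t - h n..t} \<Phi> / h n - integral {s - h n..s} \<Phi> / h n)" for n
  have h_pos: "h n > 0" "h n < s - a" for n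
    using \<open>a < s\<close> mult_strict_right_mono[of a s "real n + 1"]
    by (auto simp: h_def field_simps add_pos_nonneg)
  have h_lim: "filterlim h (at_right 0) sequentially"
  proof -
    have "(\<lambda>n. (s - a) / (2 + real n)) \<longlonglongrightarrow> 0"
      by (intro real_tendsto_divide_at_top[OF tendsto_const]
          filterlim_tendsto_add_at_top[OF tendsto_const] filterlim_real_sequentially)
    then show ?thesis
      using h_pos by (auto simp: filterlim_at h_def[abs_def] eventually_sequentially)
  qed
  have [measurable]: "\<Phi> \<in> borel_measurable borel"
    using cont by (rule borel_measurable_continuous_onI)
  have int_\<kappa>: "integrable lborel (\<lambda>b. indicator {s..t} b * \<kappa> b)"
    and int_q: "integrable lborel (\<lambda>b. indicator {s..t} b * q b)"
    using \<kappa> q by (simp_all add: set_integrable_def)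
  have [measurable]: "(\<lambda>b. indicator {s..t} b * \<kappa> b) \<in> borel_measurable borel"
    "(\<lambda>b. indicator {s..t} b * q b) \<in> borel_measurable borel"
    using int_\<kappa> int_q by (auto dest: borel_measurable_integrable)
  have int_D: "has_bochner_integral lborel (\<lambda>b. indicator {s..t} b * ((\<Phi> b - \<Phi> (b - h n)) / h n))
      (integral {t - h n..t} \<Phi> / h n - integral {s - h n..s} \<Phi> / h n)" for n
  proof -
    let ?D = "\<lambda>b. (\<Phi> b - \<Phi> (b - h n)) / h n"
    have "continuous_on {s..t} ?D"
      using h_pos[of n] by (intro continuous_intros continuous_on_compose2[OF cont]) auto
    then have D: "set_integrable lborel {s..t} ?D"
      by (rule borel_integrable_atLeastAtMost')
    have "set_lebesgue_integral lborel {s..t} ?D = integral {s..t} ?D"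
      using D by (rule set_borel_integral_eq_integral)
    also have "\<dots> = integral {t - h n..t} \<Phi> / h n - integral {s - h n..s} \<Phi> / h n"
      using has_integral_left_difference_quotient[OF cont \<open>s \<le> t\<close> h_pos(1)[of n]] by (rule integral_unique)
    finally show ?thesis
      using D by (auto simp: has_bochner_integral_iff set_integrable_def set_lebesgue_integral_def)
  qed
  have u_eq: "u n b = indicator {s..t} b * \<kappa> b - indicator {s..t} b * ((\<Phi> b - \<Phi> (b - h n)) / h n)" for n b
    by (simp add: u_def algebra_simps)
  have u_int: "has_bochner_integral lborel (u n) (I n)" for n
    unfolding u_eq[abs_def] I_def
    by (intro has_bochner_integral_diff int_D has_bochner_integral_integrable int_\<kappa>)
  have u_nonneg: "AE b in lborel. 0 \<le> u n b" for n
    using bound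
  proof eventually_elim
    case (elim b)
    show ?case
    proof (cases "b \<in> {s..t}")
      case True
      then have "\<Phi> b - \<Phi> (b - h n) \<le> h n * \<kappa> b" using elim h_pos[of n] by (auto dest!: spec[of _ "b - h n"])
      then show ?thesis using h_pos[of n] True by (simp add: u_def field_simps)
    qed (simp add: u_def)
  qed
  have nn_u: "(\<integral>\<^sup>+b. ennreal (u n b) \<partial>lborel) = ennreal (I n)" for n
    using u_int[of n] u_nonneg[of n]
    by (simp add: has_bochner_integral_iff nn_integral_eq_integral)
  have I_nonneg: "0 \<le> I n" for n
    using u_int[of n] u_nonneg[of n] integral_nonneg_AE[where M = lborel and f = "u n"] by (simp add: has_bochner_integral_iff)
  define L where "L = (LINT b|lborel. indicator {s..t} b * \<kappa> b) - (\<Phi> t - \<Phi> s)"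
  have I_lim: "I \<longlonglongrightarrow> L"
    unfolding I_def L_def
    by (intro tendsto_intros filterlim_compose[OF left_average_tendsto[OF cont] h_lim])
  have liminf: "AE b in lborel. ennreal (indicator {s..t} b * \<kappa> b - indicator {s..t} b * q b)
                  \<le> liminf (\<lambda>n. ennreal (u n b))"
    using limsup
  proof eventually_elim
    case (elim b)
    show ?case
    proof (cases "b \<in> {s..t}")
      case True
      have "ennreal (\<kappa> b - q b) \<le> liminf (\<lambda>n. ennreal (u n b)) + ennreal e" if "e > 0" for e
      proof -
        have "\<forall>\<^sub>F n in sequentially. (\<Phi> b - \<Phi> (b - h n)) / h n \<le> q b + e"
          using elim True that by (intro eventually_compose_filterlim[OF _ h_lim]) simp
        then have "\<forall>\<^sub>F n in sequentially. ennreal (\<kappa> b - q b - e) \<le> ennreal (u n b)"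
          by eventually_elim (use True in \<open>auto simp: u_def intro!: ennreal_leI\<close>)
        then have "ennreal (\<kappa> b - q b - e) \<le> liminf (\<lambda>n. ennreal (u n b))"
          by (rule Liminf_bounded)
        then have "ennreal (\<kappa> b - q b - e) + ennreal e \<le> liminf (\<lambda>n. ennreal (u n b)) + ennreal e"
          by (rule add_right_mono)
        moreover have "ennreal (\<kappa> b - q b) \<le> ennreal (\<kappa> b - q b - e) + ennreal e"
          using that by (cases "e \<le> \<kappa> b - q b") (auto simp: ennreal_neg simp flip: ennreal_plus intro!: ennreal_leI)
        ultimately show ?thesis by (rule order.trans[rotated])
      qed
      then have "ennreal (\<kappa> b - q b) \<le> liminf (\<lambda>n. ennreal (u n b))"
        by - (rule ennreal_le_epsilon)
      then show ?thesis using True by simp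
    qed simp
  qed
  have [measurable]: "u n \<in> borel_measurable borel" for n
    using u_int[of n] by (auto simp: has_bochner_integral_iff dest: borel_measurable_integrable)
  have "ennreal (LINT b|lborel. indicator {s..t} b * \<kappa> b - indicator {s..t} b * q b)
          \<le> (\<integral>\<^sup>+b. ennreal (indicator {s..t} b * \<kappa> b - indicator {s..t} b * q b) \<partial>lborel)"
    using int_\<kappa> int_q by (intro integral_le_nn_integral) auto
  also have "\<dots> \<le> (\<integral>\<^sup>+b. liminf (\<lambda>n. ennreal (u n b)) \<partial>lborel)"
    using liminf by (rule nn_integral_mono_AE)
  also have "\<dots> \<le> liminf (\<lambda>n. \<integral>\<^sup>+b. ennreal (u n b) \<partial>lborel)"
    by (rule nn_integral_liminf) simp
  also have "\<dots> = ennreal L"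
    using I_lim by (auto simp: nn_u intro!: lim_imp_Liminf)
  finally have "(LINT b|lborel. indicator {s..t} b * \<kappa> b - indicator {s..t} b * q b) \<le> L"
    using LIMSEQ_le_const[OF I_lim, of 0] I_nonneg by (simp add: ennreal_le_iff)
  then show ?thesis
    using int_\<kappa> int_q by (simp add: L_def set_lebesgue_integral_def)
qed

section \<open>The energy inequality\<close>

text \<open>
  The exceptional set can be chosen independently of the vector \<open>v\<close>: differentiate on a countable
  dense set of vectors, and carry the limit over to all vectors, the averages of \<open>\<gamma>\<close> being
  Lipschitz constants for the averages of \<open>g\<close>.
\<close>

lemma AE_left_average_blinfun_tendsto:
  fixes g :: "real \<Rightarrow> ('v::{real_normed_vector, second_countable_topology} \<Rightarrow>\<^sub>L real)"
  assumes g: "\<And>v a b. (\<lambda>r. g r v) integrable_on {a..b}"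
    and \<gamma>: "\<And>a b. \<gamma> integrable_on {a..b}"
    and bound: "\<And>r. norm (g r) \<le> \<gamma> r"
  shows "AE b in lborel. \<forall>v. ((\<lambda>h. integral {b - h..b} (\<lambda>r. g r v) / h) \<longlongrightarrow> g b v) (at_right 0)"
proof -
  obtain D :: "'v set" where D: "countable D" "\<And>X. open X \<Longrightarrow> X \<noteq> {} \<Longrightarrow> \<exists>d\<in>D. d \<in> X"
    by (erule countable_dense_setE)
  have "AE b in lborel. \<forall>d\<in>D. ((\<lambda>h. integral {b - h..b} (\<lambda>r. g r d) / h) \<longlongrightarrow> g b d) (at_right 0)"
    using D(1) AE_left_average_tendsto[OF g] by (simp add: AE_ball_countable)
  with AE_left_average_tendsto[OF \<gamma>] show ?thesis
  proof eventually_elim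
    case (elim b)
    show ?case
    proof (intro allI tendstoI)
      fix v and e :: real assume "0 < e"
      define c where "c = \<gamma> b + 1"
      have "0 < c" using bound[of b] norm_ge_zero[of "g b"] by (simp add: c_def del: norm_ge_zero)
      have "0 < e / (3 * c)" using \<open>0 < e\<close> \<open>0 < c\<close> by simp
      then obtain d where "d \<in> D" and d: "norm (v - d) < e / (3 * c)"
        using D(2)[of "ball v (e / (3 * c))"] by (auto simp: dist_norm not_le simp del: zero_less_divide_iff divide_le_0_iff)
      have small: "c * norm (v - d) < e / 3"
        using d \<open>0 < c\<close> by (simp add: field_simps)
      have "\<forall>\<^sub>F h in at_right 0. integral {b - h..b} \<gamma> / h < c"
        using elim(1) by (rule order_tendstoD) (simp add: c_def)
      moreover have "\<forall>\<^sub>F h in at_right 0. dist (integral {b - h..b} (\<lambda>r. g r d) / h) (g b d) < e / 3"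
        using elim(2) \<open>d \<in> D\<close> \<open>0 < e\<close> by (intro tendstoD) auto
      moreover have "\<forall>\<^sub>F h in at_right 0. (0::real) < h"
        by (rule eventually_at_right_less)
      ultimately show "\<forall>\<^sub>F h in at_right 0. dist (integral {b - h..b} (\<lambda>r. g r v) / h) (g b v) < e"
      proof eventually_elim
        case (elim h)
        have "\<bar>integral {b - h..b} (\<lambda>r. g r v) - integral {b - h..b} (\<lambda>r. g r d)\<bar>
              = norm (integral {b - h..b} (\<lambda>r. g r (v - d)))"
          using g by (simp add: Henstock_Kurzweil_Integration.integral_diff blinfun.diff_right)
        also have "\<dots> \<le> integral {b - h..b} (\<lambda>r. \<gamma> r * norm (v - d))"
        proof (rule integral_norm_bound_integral)
          show "norm (g r (v - d)) \<le> \<gamma> r * norm (v - d)" for r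
            using norm_blinfun[of "g r" "v - d"] mult_right_mono[OF bound[of r] norm_ge_zero[of "v - d"]]
            by linarith
        qed (use g \<gamma> in \<open>auto intro: integrable_on_mult_left\<close>)
        also have "\<dots> = integral {b - h..b} \<gamma> * norm (v - d)"
          by simp
        also have "\<dots> \<le> h * (c * norm (v - d))"
          using elim(1,3) mult_right_mono[of "integral {b - h..b} \<gamma>" "h * c" "norm (v - d)"]
          by (simp add: field_simps)
        also have "\<dots> \<le> h * (e / 3)"
          using small elim(3) by (intro mult_left_mono) auto
        finally have "\<bar>integral {b - h..b} (\<lambda>r. g r v) / h - integral {b - h..b} (\<lambda>r. g r d) / h\<bar> \<le> e / 3"
          using elim(3) by (simp add: abs_divide field_simps flip: diff_divide_distrib)
        moreover have "\<bar>g b v - g b d\<bar> \<le> e / 3"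
        proof -
          have "\<bar>g b v - g b d\<bar> \<le> norm (g b) * norm (v - d)"
            using norm_blinfun[of "g b" "v - d"] by (simp add: blinfun.diff_right)
          also have "\<dots> \<le> c * norm (v - d)"
            using bound[of b] by (intro mult_right_mono) (auto simp: c_def)
          finally show ?thesis using small by linarith
        qed
        ultimately show ?case using elim(2) unfolding dist_real_def by linarith
      qed
    qed
  qed
qed

lemma powr_add_le:
  fixes a b p :: real
  assumes "0 \<le> a" "0 \<le> b" "0 \<le> p"
  shows "(a + b) powr p \<le> 2 powr p * (a powr p + b powr p)"
proof -
  have "(a + b) powr p \<le> (2 * max a b) powr p"
    using assms by (intro powr_mono2) auto
  also have "\<dots> = 2 powr p * max a b powr p"
    using assms by (simp add: powr_mult)
  also have "\<dots> \<le> 2 powr p * (a powr p + b powr p)"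
    by (intro mult_left_mono) (auto simp: max_def)
  finally show ?thesis .
qed

text \<open>
  The inequality half of the chain rule for \<open>|w|\<^sup>2\<close> in a Gelfand triple. The times at which \<open>w\<close> is not
  in \<open>V\<close>, or at which the averages of \<open>g\<close> do not converge, form a null set, and the increment lemma
  asks for its bounds only almost everywhere. Its majorant comes from Young's inequality
  \<open>\<langle>g(r), z(b)\<rangle> \<le> \<gamma>(r)\<^bsup>p'\<^esup> + |z(b)|\<^bsup>p\<^esup>\<close>, whose first term depends on \<open>r\<close> rather than on \<open>b\<close>. Therefore the lemma
  is applied to \<open>|w|\<^sup>2\<close> minus twice the primitive of \<open>\<gamma>\<^bsup>p'\<^esup>\<close>, and the correction cancels in the end.
\<close>

lemma energy_inequality:
  fixes \<iota> :: "'v::{real_normed_vector, second_countable_topology} \<Rightarrow> 'h::real_inner"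
    and g :: "real \<Rightarrow> ('v \<Rightarrow>\<^sub>L real)"
  assumes "a < s" "s \<le> t"
    and w: "continuous_on {a..t} w"
    and wz: "AE r in lborel. r \<in> {a..t} \<longrightarrow> w r = \<iota> (z r)"
    and g: "\<And>v b. b \<in> {a..t} \<Longrightarrow> ((\<lambda>r. g r v) has_integral (w b - w a) \<bullet> \<iota> v) {a..b}"
    and bound: "\<And>r. norm (g r) \<le> \<gamma> r"
    and pp': "1 < p" "1 < p'" "1 / p + 1 / p' = 1"
    and \<gamma>: "\<gamma> \<in> borel_measurable lborel" "set_integrable lborel {a..t} (\<lambda>r. \<gamma> r powr p')"
    and z: "set_integrable lborel {a..t} (\<lambda>r. norm (z r) powr p)"
    and q: "set_integrable lborel {s..t} q" "AE r in lborel. r \<in> {s..t} \<longrightarrow> 2 * g r (z r) \<le> q r"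
  shows "(norm (w t))\<^sup>2 - (norm (w s))\<^sup>2 \<le> set_lebesgue_integral lborel {s..t} q"
proof -
  \<comment> \<open>Freezing the argument outside \<open>[a,t]\<close> makes \<open>|w|\<^sup>2\<close> and the primitive of \<open>k\<close> continuous on the whole line.\<close>
  define clamp where "clamp r = max a (min t r)" for r
  define \<psi> where "\<psi> r = (norm (w (clamp r)))\<^sup>2" for r
  define k where "k r = indicator {a..t} r * \<gamma> r powr p'" for r
  define K where "K r = integral {a..clamp r} k" for r
  have clamp: "clamp r = r" if "r \<in> {a..t}" for r
    using that by (simp add: clamp_def)
  have clamp_cont: "continuous_on UNIV clamp"
    unfolding clamp_def[abs_def] by (intro continuous_intros)
  have clamp_range: "range clamp \<subseteq> {a..t}"
    using assms(1,2) by (auto simp: clamp_def)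
  have \<gamma>_nonneg: "0 \<le> \<gamma> r" for r
    using bound[of r] norm_ge_zero order.trans by blast
  have young: "g r v \<le> \<gamma> r powr p' + norm v powr p" for r v
  proof -
    have "g r v \<le> \<gamma> r * norm v"
      using norm_blinfun[of "g r" v] mult_right_mono[OF bound[of r] norm_ge_zero[of v]] by simp
    also have "\<dots> \<le> \<gamma> r powr p' / p' + norm v powr p / p"
      using pp' \<gamma>_nonneg by (intro Youngs_inequality) auto
    also have "\<dots> \<le> \<gamma> r powr p' + norm v powr p"
      using pp' divide_left_mono[of 1 p' "\<gamma> r powr p'"] divide_left_mono[of 1 p "norm v powr p"]
      by (intro add_mono) auto
    finally show ?thesis .
  qed
  have k_int: "integrable lborel k"
    using \<gamma>(2) by (simp add: set_integrable_def k_def[abs_def])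
  have k_HK: "k integrable_on {x..y}" for x y
    using integrable_on_lborel[OF k_int] by (rule integrable_on_subinterval) simp
  have g_int: "((\<lambda>x. g x v) has_integral (w y - w x) \<bullet> \<iota> v) {x..y}"
    if "a \<le> x" "x \<le> y" "y \<le> t" for v x y
  proof -
    have "(\<lambda>x. g x v) integrable_on {a..y}"
      using g[of y v] that by auto
    moreover from this have "(\<lambda>x. g x v) integrable_on {x..y}"
      by (rule integrable_on_subinterval) (use that in auto)
    ultimately show ?thesis
      using Henstock_Kurzweil_Integration.integral_combine[of a x y "\<lambda>x. g x v"] that
        integral_unique[OF g[of x v]] integral_unique[OF g[of y v]]
      by (simp add: has_integral_iff inner_diff_left)
  qed
  have K_diff: "K y - K x = integral {x..y} k" if "a \<le> x" "x \<le> y" "y \<le> t" for x y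
    using Henstock_Kurzweil_Integration.integral_combine[of a x y k] that k_HK
    by (simp add: K_def clamp)
  have \<psi>_diff: "\<psi> y - \<psi> x \<le> 2 * integral {x..y} (\<lambda>r. g r (z y))"
    if "a \<le> x" "x \<le> y" "y \<le> t" "w y = \<iota> (z y)" for x y
  proof -
    \<comment> \<open>Only an inequality results, and only with the right endpoint in the second factor.\<close>
    have "\<psi> y - \<psi> x = 2 * ((w y - w x) \<bullet> w y) - (norm (w y - w x))\<^sup>2"
      using that by (simp add: \<psi>_def clamp power2_norm_eq_inner inner_diff_left inner_diff_right inner_commute)
    also have "\<dots> \<le> 2 * ((w y - w x) \<bullet> w y)" by simp
    finally show ?thesis
      using integral_unique[OF g_int[OF that(1-3), of "z y"]] that(4) by simp
  qed
  have "continuous_on UNIV \<psi>"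
    unfolding \<psi>_def using clamp_range
    by (intro continuous_intros continuous_on_compose2[OF w clamp_cont]) auto
  moreover have "continuous_on UNIV K"
    unfolding K_def using clamp_range
    by (intro continuous_on_compose2[OF indefinite_integral_continuous_1[OF k_HK] clamp_cont]) auto
  ultimately have cont: "continuous_on UNIV (\<lambda>r. \<psi> r - 2 * K r)"
    by (intro continuous_intros)

  define G where "G r = indicat_real {a..t} r *\<^sub>R g r" for r
  define \<Gamma> where "\<Gamma> r = indicat_real {a..t} r * \<gamma> r" for r
  have G_int: "(\<lambda>r. G r v) integrable_on {x..y}" for v x y
  proof -
    have "(\<lambda>r. if r \<in> {a..t} then g r v else 0) integrable_on UNIV"
      using g[of t v] assms(1,2) by (subst integrable_restrict_UNIV) auto
    then have "(\<lambda>r. G r v) integrable_on UNIV"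
      by (rule integrable_eq) (simp add: G_def blinfun.scaleR_left indicator_def)
    then show ?thesis by (rule integrable_on_subinterval) simp
  qed
  have "integrable lborel \<Gamma>"
  proof (rule Bochner_Integration.integrable_bound)
    show "integrable lborel (\<lambda>r. indicat_real {a..t} r + k r)"
      using k_int by (intro Bochner_Integration.integrable_add integrable_real_indicator)
        (auto simp: emeasure_lborel_Icc_eq)
    show "\<Gamma> \<in> borel_measurable lborel"
      unfolding \<Gamma>_def using \<gamma>(1) by measurable
    \<comment> \<open>The indicator has finite integral, so higher integrability of \<open>\<gamma>\<close> gives integrability.\<close>
    have "\<gamma> r \<le> 1 + \<gamma> r powr p'" for r
    proof (cases "\<gamma> r \<le> 1")
      case False
      then have "\<gamma> r powr 1 \<le> \<gamma> r powr p'"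
        using pp' by (intro powr_mono) auto
      then show ?thesis using False by simp
    qed (simp add: add_increasing2)
    then show "AE r in lborel. norm (\<Gamma> r) \<le> norm (indicat_real {a..t} r + k r)"
      using \<gamma>_nonneg by (intro AE_I2) (simp add: \<Gamma>_def k_def indicator_def)
  qed
  then have "\<Gamma> integrable_on {x..y}" for x y
    by (intro integrable_on_subinterval[OF integrable_on_lborel]) auto
  then have G_lim: "AE b in lborel. \<forall>v. ((\<lambda>h. integral {b - h..b} (\<lambda>r. G r v) / h) \<longlongrightarrow> G b v) (at_right 0)"
    using bound by (intro AE_left_average_blinfun_tendsto[of G \<Gamma>] G_int)
      (auto simp: G_def \<Gamma>_def indicator_def)
  have k_lim: "AE b in lborel. ((\<lambda>h. integral {b - h..b} k / h) \<longlongrightarrow> k b) (at_right 0)"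
    by (intro AE_left_average_tendsto k_HK)

  have "set_integrable lborel UNIV k"
    using k_int by (simp add: set_integrable_def)
  then have k_set: "set_integrable lborel {s..t} k"
    by (rule set_integrable_subset) auto
  have "(\<psi> t - 2 * K t) - (\<psi> s - 2 * K s) \<le> (LBINT r:{s..t}. q r - 2 * k r)"
  proof (rule increment_le_integral_of_left_derivative_bound[OF cont \<open>a < s\<close> \<open>s \<le> t\<close>])
    show "set_integrable lborel {s..t} (\<lambda>r. 2 * norm (z r) powr p)"
      using \<open>a < s\<close> by (intro set_integrable_mult_right impI set_integrable_subset[OF z]) auto
    show "set_integrable lborel {s..t} (\<lambda>r. q r - 2 * k r)"
      by (intro set_integral_diff(1) q(1) set_integrable_mult_right impI k_set)
    show "AE b in lborel. b \<in> {s..t} \<longrightarrow> (\<forall>r. a \<le> r \<and> r < b \<longrightarrow>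
            (\<psi> b - 2 * K b) - (\<psi> r - 2 * K r) \<le> (b - r) * (2 * norm (z b) powr p))"
      using wz
    proof (eventually_elim, intro impI allI)
      fix b r
      assume eq: "b \<in> {a..t} \<longrightarrow> w b = \<iota> (z b)" and b: "b \<in> {s..t}" and r: "a \<le> r \<and> r < b"
      have "integral {r..b} (\<lambda>x. g x (z b)) \<le> integral {r..b} (\<lambda>x. k x + norm (z b) powr p)"
      proof (rule integral_le)
        show "(\<lambda>x. g x (z b)) integrable_on {r..b}"
          using g_int[of r b "z b"] b r by auto
        show "(\<lambda>x. k x + norm (z b) powr p) integrable_on {r..b}"
          by (intro integrable_add k_HK) auto
        show "g x (z b) \<le> k x + norm (z b) powr p" if "x \<in> {r..b}" for x
          using young[of x "z b"] that b r by (simp add: k_def)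
      qed
      also have "\<dots> = K b - K r + (b - r) * norm (z b) powr p"
        using K_diff[of r b] b r k_HK
        by (simp add: Henstock_Kurzweil_Integration.integral_add[OF k_HK integrable_const_ivl])
      finally show "(\<psi> b - 2 * K b) - (\<psi> r - 2 * K r) \<le> (b - r) * (2 * norm (z b) powr p)"
        using \<psi>_diff[of r b] eq b r \<open>a < s\<close> by simp
    qed
    show "AE b in lborel. b \<in> {s..t} \<longrightarrow> (\<forall>e>0. \<forall>\<^sub>F h in at_right 0.
            ((\<psi> b - 2 * K b) - (\<psi> (b - h) - 2 * K (b - h))) / h \<le> q b - 2 * k b + e)"
      using wz G_lim k_lim q(2)
    proof (eventually_elim, intro impI allI)
      fix b and e :: real
      assume eq: "b \<in> {a..t} \<longrightarrow> w b = \<iota> (z b)" and b: "b \<in> {s..t}" and "0 < e"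
        and G: "\<forall>v. ((\<lambda>h. integral {b - h..b} (\<lambda>r. G r v) / h) \<longlongrightarrow> G b v) (at_right 0)"
        and k: "((\<lambda>h. integral {b - h..b} k / h) \<longlongrightarrow> k b) (at_right 0)"
        and qb: "b \<in> {s..t} \<longrightarrow> 2 * g b (z b) \<le> q b"
      have "((\<lambda>h. 2 * (integral {b - h..b} (\<lambda>r. G r (z b)) / h) - 2 * (integral {b - h..b} k / h))
              \<longlongrightarrow> 2 * G b (z b) - 2 * k b) (at_right 0)"
        by (intro tendsto_intros G[rule_format] k)
      moreover have "2 * G b (z b) - 2 * k b < q b - 2 * k b + e"
        using qb b \<open>0 < e\<close> \<open>a < s\<close> by (simp add: G_def)
      ultimately have "\<forall>\<^sub>F h in at_right 0. 2 * (integral {b - h..b} (\<lambda>r. G r (z b)) / h)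
          - 2 * (integral {b - h..b} k / h) < q b - 2 * k b + e"
        by (rule order_tendstoD)
      moreover have "\<forall>\<^sub>F h in at_right 0. 0 < h \<and> h < s - a"
        using \<open>a < s\<close> by (auto simp: eventually_at_right_field intro!: exI[of _ "s - a"])
      ultimately show "\<forall>\<^sub>F h in at_right 0.
            ((\<psi> b - 2 * K b) - (\<psi> (b - h) - 2 * K (b - h))) / h \<le> q b - 2 * k b + e"
      proof eventually_elim
        case (elim h)
        have "integral {b - h..b} (\<lambda>r. G r (z b)) = integral {b - h..b} (\<lambda>r. g r (z b))"
          using b elim by (intro Henstock_Kurzweil_Integration.integral_cong) (auto simp: G_def)
        then have "(\<psi> b - 2 * K b) - (\<psi> (b - h) - 2 * K (b - h))
            \<le> 2 * integral {b - h..b} (\<lambda>r. G r (z b)) - 2 * integral {b - h..b} k"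
          using \<psi>_diff[of "b - h" b] K_diff[of "b - h" b] eq b elim by simp
        then have "((\<psi> b - 2 * K b) - (\<psi> (b - h) - 2 * K (b - h))) / h
            \<le> (2 * integral {b - h..b} (\<lambda>r. G r (z b)) - 2 * integral {b - h..b} k) / h"
          using elim by (intro divide_right_mono) auto
        then show ?case using elim(1) by (simp add: diff_divide_distrib)
      qed
    qed
  qed
  also have "(LBINT r:{s..t}. q r - 2 * k r) = (LBINT r:{s..t}. q r) - 2 * (LBINT r:{s..t}. k r)"
    using k_set by (subst set_integral_diff(2)) (auto intro!: q(1) set_integrable_mult_right)
  also have "(LBINT r:{s..t}. k r) = K t - K s"
    using k_set assms(1,2) by (simp add: set_borel_integral_eq_integral(2) K_diff)
  finally show ?thesis
    using assms(1,2) by (simp add: \<psi>_def clamp)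
qed

section \<open>Strict contraction of the flow\<close>

lemma set_integrable_powr_le_add:
  fixes a b c :: "'a \<Rightarrow> real"
  assumes a: "set_integrable M S (\<lambda>r. a r powr p)" and b: "set_integrable M S (\<lambda>r. b r powr p)"
    and c: "c \<in> borel_measurable M" and [measurable]: "S \<in> sets M" and "0 \<le> p"
    and nonneg: "\<And>r. 0 \<le> a r" "\<And>r. 0 \<le> b r" "\<And>r. 0 \<le> c r" and le: "\<And>r. c r \<le> a r + b r"
  shows "set_integrable M S (\<lambda>r. c r powr p)"
proof (rule set_integrable_bound)
  show "set_integrable M S (\<lambda>r. 2 powr p * (a r powr p + b r powr p))"
    by (intro set_integrable_mult_right impI set_integral_add(1) a b)
  show "set_borel_measurable M S (\<lambda>r. c r powr p)"
    unfolding set_borel_measurable_def using c by measurable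
  have "c r powr p \<le> 2 powr p * (a r powr p + b r powr p)" for r
    using powr_mono2[OF \<open>0 \<le> p\<close> nonneg(3) le, of r] powr_add_le[of "a r" "b r" p] nonneg \<open>0 \<le> p\<close>
    by (meson order.trans)
  then show "AE r in M. r \<in> S \<longrightarrow> norm (c r powr p) \<le> norm (2 powr p * (a r powr p + b r powr p))"
    by auto
qed

lemma to_dual_apply:
  assumes "bounded_linear \<iota>"
  shows "blinfun_apply (to_dual \<iota> h) v = h \<bullet> \<iota> v"
proof -
  have "bounded_linear (\<lambda>v. h \<bullet> \<iota> v)"
    by (rule bounded_linear_compose[OF bounded_linear_inner_right assms])
  then show ?thesis by (simp add: to_dual_def bounded_linear_Blinfun_apply)
qed

lemma extend_zero_embedding:
  assumes "inj \<iota>"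
  shows "extend_zero \<iota> A (\<iota> v) = A v"
  using assms by (simp add: extend_zero_def)

text \<open>
  The equation at time \<open>s\<close> identifies \<open>u s\<close> and \<open>x\<close> only as functionals on \<open>V\<close>; density of \<open>V\<close> in \<open>H\<close>
  makes them equal.
\<close>

lemma is_solution_initial:
  assumes gt: "gelfand_triple \<iota>" and sol: "is_solution \<iota> A \<alpha> n s x u"
  shows "u s = x"
proof -
  have \<iota>: "bounded_linear \<iota>" "closure (range \<iota>) = UNIV"
    using gt by (auto simp: gelfand_triple_def)
  have "((\<lambda>r. extend_zero \<iota> A (u r + \<iota> (n r))) has_integral (to_dual \<iota> (u s) - to_dual \<iota> x)) {s}"
    using sol unfolding is_solution_def by (metis atLeastAtMost_singleton order_refl)
  then have eq: "to_dual \<iota> (u s) = to_dual \<iota> x"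
    by (auto dest: has_integral_unique[OF has_integral_refl(2)])
  have "(u s - x) \<bullet> y = 0" if "y \<in> range \<iota>" for y
    using that to_dual_apply[OF \<iota>(1), of "u s"] to_dual_apply[OF \<iota>(1), of x] eq
    by (auto simp: inner_diff_left)
  then have "(u s - x) \<bullet> y = 0" if "y \<in> closure (range \<iota>)" for y
    using that by (intro continuous_constant_on_closure[of "range \<iota>" "\<lambda>y. (u s - x) \<bullet> y" 0 y])
      (auto intro!: continuous_intros)
  then have "(u s - x) \<bullet> (u s - x) = 0" using \<iota>(2) by blast
  then show ?thesis by simp
qed

text \<open>
  Testing the equation with \<open>v \<in> V\<close> turns it into a scalar one, and the integrand may be replaced by
  the drift at a \<open>V\<close>-valued representative of solution plus noise, which is defined at every time.
\<close>

lemma is_solution_weak: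
  assumes gt: "gelfand_triple \<iota>" and sol: "is_solution \<iota> A \<alpha> n s x u"
    and uz: "AE r in lborel. s \<le> r \<longrightarrow> u r = \<iota> (z r)" and "s \<le> t"
  shows "((\<lambda>r. A (z r + n r) v) has_integral (u t - x) \<bullet> \<iota> v) {s..t}"
proof -
  have \<iota>: "bounded_linear \<iota>" "inj \<iota>"
    using gt by (auto simp: gelfand_triple_def)
  have "((\<lambda>r. extend_zero \<iota> A (u r + \<iota> (n r)) v) has_integral (to_dual \<iota> (u t) - to_dual \<iota> x) v) {s..t}"
    using sol \<open>s \<le> t\<close> has_integral_linear[OF _ blinfun.bounded_linear_left]
    unfolding is_solution_def o_def by blast
  moreover have "(to_dual \<iota> (u t) - to_dual \<iota> x) v = (u t - x) \<bullet> \<iota> v"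
    by (simp add: blinfun.diff_left to_dual_apply[OF \<iota>(1)] inner_diff_left)
  moreover have "AE r in lborel. r \<in> {s..t} \<longrightarrow> extend_zero \<iota> A (u r + \<iota> (n r)) v = A (z r + n r) v"
    using uz by eventually_elim
      (auto simp: extend_zero_embedding[OF \<iota>(2)] simp flip: bounded_linear.linear[OF \<iota>(1), THEN linear_add])
  ultimately show ?thesis
    by (simp add: has_integral_AE)
qed

text \<open>
  Both solutions see the same noise path, so it cancels in their difference \<open>w\<close>, and the energy
  inequality together with strict monotonicity of the drift gives \<open>d|w|\<^sup>2 \<le> -m dr\<close> with \<open>m\<close> positive
  wherever \<open>w\<close> does not vanish. If the distance did not drop between \<open>s\<close> and \<open>t\<close>, then \<open>w\<close> would stay
  away from zero while \<open>m\<close> vanishes almost everywhere on an interval of positive length.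
\<close>

lemma solutions_strictly_contract:
  fixes \<iota> :: "'v::{banach, second_countable_topology}
               \<Rightarrow> 'h::{real_inner, banach, second_countable_topology}"
  assumes gt: "gelfand_triple \<iota>" and drift: "drift_condition \<iota> A \<alpha> f c C2"
    and n: "continuous_on UNIV n"
    and sol1: "is_solution \<iota> A \<alpha> n s x1 u1" and sol2: "is_solution \<iota> A \<alpha> n s x2 u2"
    and "x1 \<noteq> x2" "s < t"
  shows "norm (u1 t - u2 t) < norm (x1 - x2)"
proof -
  have \<iota>: "bounded_linear \<iota>" "inj \<iota>"
    using gt by (auto simp: gelfand_triple_def)
  interpret \<iota>: bounded_linear \<iota> by fact
  have [measurable]: "A \<in> borel_measurable borel"
    and \<alpha>: "1 < \<alpha>" "0 < f" "0 < C2"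
    and growth: "\<And>v. norm (A v) powr (\<alpha> / (\<alpha> - 1)) \<le> C2 * norm v powr \<alpha> + f"
    using drift by (auto simp: drift_condition_def)
  have "\<exists>c' \<delta>. 0 < c' \<and> 0 < \<delta> \<and> \<delta> < \<alpha> \<and> (\<forall>v1 v2. 2 * (A v1 - A v2) (v1 - v2)
      \<le> - c' * ((norm (\<iota> v1 - \<iota> v2))\<^sup>2 / (norm v1 powr \<delta> + norm v2 powr \<delta>)))"
    using drift unfolding drift_condition_def by (elim conjE)
  then obtain c' \<delta> where c': "0 < c'"
    and mono: "\<And>v1 v2. 2 * (A v1 - A v2) (v1 - v2)
      \<le> - c' * ((norm (\<iota> v1 - \<iota> v2))\<^sup>2 / (norm v1 powr \<delta> + norm v2 powr \<delta>))"
    by blast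
  obtain z1 where z1: "z1 \<in> borel_measurable lborel" "AE r in lborel. s \<le> r \<longrightarrow> u1 r = \<iota> (z1 r)"
      "\<And>t. s \<le> t \<Longrightarrow> set_integrable lborel {s..t} (\<lambda>r. norm (z1 r) powr \<alpha>)"
    using sol1 unfolding is_solution_def Lp_loc_from_def by blast
  obtain z2 where z2: "z2 \<in> borel_measurable lborel" "AE r in lborel. s \<le> r \<longrightarrow> u2 r = \<iota> (z2 r)"
      "\<And>t. s \<le> t \<Longrightarrow> set_integrable lborel {s..t} (\<lambda>r. norm (z2 r) powr \<alpha>)"
    using sol2 unfolding is_solution_def Lp_loc_from_def by blast
  note [measurable] = z1(1) z2(1)
  have [measurable]: "n \<in> borel_measurable borel" "\<iota> \<in> borel_measurable borel"
    using n \<iota>.continuous_on[OF continuous_on_id] by (auto intro: borel_measurable_continuous_onI)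
  define w where "w r = u1 r - u2 r" for r
  define z where "z r = z1 r - z2 r" for r
  define v1 where "v1 r = z1 r + n r" for r
  define v2 where "v2 r = z2 r + n r" for r
  define g where "g r = A (v1 r) - A (v2 r)" for r
  define \<gamma> where "\<gamma> r = norm (A (v1 r)) + norm (A (v2 r))" for r
  define m where "m r = c' * ((norm (\<iota> (z r)))\<^sup>2 / (norm (v1 r) powr \<delta> + norm (v2 r) powr \<delta>))" for r
  have [measurable]: "v1 \<in> borel_measurable borel" "v2 \<in> borel_measurable borel" "z \<in> borel_measurable borel"
    using z1(1) z2(1) unfolding v1_def[abs_def] v2_def[abs_def] z_def[abs_def] by simp_all
  have w_cont: "continuous_on {s..} w"
    using sol1 sol2 unfolding w_def[abs_def] is_solution_def by (intro continuous_intros) auto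
  have wz: "AE r in lborel. s \<le> r \<longrightarrow> w r = \<iota> (z r)"
    using z1(2) z2(2) by eventually_elim (simp add: w_def z_def \<iota>.diff)
  have ws: "w s = x1 - x2"
    using is_solution_initial[OF gt sol1] is_solution_initial[OF gt sol2] by (simp add: w_def)
  have n_int: "set_integrable lborel {s..r} (\<lambda>r. norm (n r) powr \<alpha>)" for r
    using \<alpha> by (intro borel_integrable_atLeastAtMost' continuous_on_powr' continuous_intros
        continuous_on_subset[OF n]) auto
  have v_int: "set_integrable lborel {s..r} (\<lambda>r. norm (v1 r) powr \<alpha>)"
      "set_integrable lborel {s..r} (\<lambda>r. norm (v2 r) powr \<alpha>)" if "s \<le> r" for r
    using that \<alpha> set_integrable_powr_le_add[OF z1(3) n_int, of r "\<lambda>r. norm (v1 r)"]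
      set_integrable_powr_le_add[OF z2(3) n_int, of r "\<lambda>r. norm (v2 r)"]
    by (simp_all add: v1_def v2_def norm_triangle_ineq)
  have z_int: "set_integrable lborel {s..r} (\<lambda>r. norm (z r) powr \<alpha>)" if "s \<le> r" for r
    using that \<alpha> set_integrable_powr_le_add[OF z1(3) z2(3), of r "\<lambda>r. norm (z r)"]
    by (simp add: z_def norm_triangle_ineq4)
  have A_int: "set_integrable lborel {s..r} (\<lambda>r. norm (A (v r)) powr (\<alpha> / (\<alpha> - 1)))"
    if "set_integrable lborel {s..r} (\<lambda>r. norm (v r) powr \<alpha>)" and [measurable]: "v \<in> borel_measurable borel"
    for v :: "real \<Rightarrow> 'v" and r
  proof (rule set_integrable_bound)
    show "set_integrable lborel {s..r} (\<lambda>r. C2 * norm (v r) powr \<alpha> + f)"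
      using that(1) by (intro set_integral_add(1) set_integrable_mult_right impI)
        (auto intro: borel_integrable_atLeastAtMost')
    show "AE r' in lborel. r' \<in> {s..r} \<longrightarrow> norm (norm (A (v r')) powr (\<alpha> / (\<alpha> - 1)))
            \<le> norm (C2 * norm (v r') powr \<alpha> + f)"
      using growth by (auto intro: order.trans[OF _ abs_ge_self])
  qed (simp add: set_borel_measurable_def)
  have \<gamma>_int: "set_integrable lborel {s..r} (\<lambda>r. \<gamma> r powr (\<alpha> / (\<alpha> - 1)))" if "s \<le> r" for r
    using \<alpha> by (intro set_integrable_powr_le_add[OF A_int A_int, OF v_int(1) _ v_int(2)] that)
      (auto simp: \<gamma>_def[abs_def])
  have g_int: "((\<lambda>r. g r v) has_integral (w b - w s) \<bullet> \<iota> v) {s..b}" if "s \<le> b" for v b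
    using has_integral_diff[OF is_solution_weak[OF gt sol1 z1(2) that, of v] is_solution_weak[OF gt sol2 z2(2) that, of v]]
    by (simp add: g_def v1_def v2_def blinfun.diff_left w_def is_solution_initial[OF gt sol1]
        is_solution_initial[OF gt sol2] inner_diff_left algebra_simps)
  have g_mono: "2 * g r (z r) \<le> - m r" for r
    using mono[of "v1 r" "v2 r"] by (simp add: g_def m_def z_def v1_def v2_def \<iota>.diff \<iota>.add)
  have m_nonneg: "0 \<le> m r" for r
    using c' by (simp add: m_def)
  have [measurable]: "m \<in> borel_measurable borel"
    unfolding m_def[abs_def] by measurable
  \<comment> \<open>The rate \<open>m\<close> may be large where both arguments of the drift are small in \<open>V\<close>. Cutting it off at \<open>1\<close> makes it
    integrable and keeps it positive.\<close>
  have m_int: "set_integrable lborel {a..b} (\<lambda>r. - min 1 (m r))" for a b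
  proof (rule set_integrable_bound)
    show "set_integrable lborel {a..b} (\<lambda>_. 1 :: real)"
      by (rule borel_integrable_atLeastAtMost') simp
    show "AE r in lborel. r \<in> {a..b} \<longrightarrow> norm (- min 1 (m r)) \<le> norm (1::real)"
      using m_nonneg by (auto simp: min_def)
  qed (simp add: set_borel_measurable_def)
  \<comment> \<open>The energy inequality needs room to the left of \<open>a\<close>; the initial time \<open>s\<close> is reached by continuity.\<close>
  have energy: "(norm (w b))\<^sup>2 - (norm (w a))\<^sup>2 \<le> (LBINT r:{a..b}. - min 1 (m r))"
    if "s < a" "a \<le> b" for a b
  proof (rule energy_inequality[of s a b w \<iota> z g \<gamma> \<alpha> "\<alpha> / (\<alpha> - 1)"])
    show "AE r in lborel. r \<in> {s..b} \<longrightarrow> w r = \<iota> (z r)"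
      using wz by eventually_elim auto
    show "norm (g r) \<le> \<gamma> r" for r
      by (simp add: g_def \<gamma>_def norm_triangle_ineq4)
    show "1 / \<alpha> + 1 / (\<alpha> / (\<alpha> - 1)) = 1" "1 < \<alpha> / (\<alpha> - 1)"
      using \<alpha> by (simp_all add: field_simps)
    show "AE r in lborel. r \<in> {a..b} \<longrightarrow> 2 * g r (z r) \<le> - min 1 (m r)"
      using g_mono by (intro AE_I2) (smt (verit))
    show "\<gamma> \<in> borel_measurable lborel"
      unfolding \<gamma>_def[abs_def] by measurable
  qed (use that \<alpha> g_int \<gamma>_int z_int m_int in \<open>auto intro: continuous_on_subset[OF w_cont]\<close>)
  have dissipation: "(LBINT r:{a..b}. - min 1 (m r)) = - (LBINT r:{a..b}. min 1 (m r))"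
      "0 \<le> (LBINT r:{a..b}. min 1 (m r))" for a b
    using m_nonneg unfolding set_lebesgue_integral_def
    by (auto intro!: Bochner_Integration.integral_nonneg_AE AE_I2 simp: indicator_def)
  have antimono: "norm (w b) \<le> norm (w a)" if "s < a" "a \<le> b" for a b
  proof -
    have "(norm (w b))\<^sup>2 \<le> (norm (w a))\<^sup>2"
      using energy[OF that] dissipation[of a b] by linarith
    then show ?thesis by (rule power2_le_imp_le) simp
  qed
  have le_start: "norm (w t) \<le> norm (w s)" if "s < t" for t
  proof (rule tendsto_lowerbound)
    have "(w \<longlongrightarrow> w s) (at s within {s..})"
      using w_cont by (simp add: continuous_on_def)
    then show "((\<lambda>r. norm (w r)) \<longlongrightarrow> norm (w s)) (at_right s)"
      by (intro tendsto_norm) (rule tendsto_within_subset, auto)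
    show "\<forall>\<^sub>F r in at_right s. norm (w t) \<le> norm (w r)"
      using antimono that by (auto simp: eventually_at_right_field)
  qed simp
  show ?thesis
  proof (rule ccontr)
    assume "\<not> ?thesis"
    then have ge: "norm (w s) \<le> norm (w t)" and pos: "0 < norm (w t)"
      using ws \<open>x1 \<noteq> x2\<close> by (auto simp: w_def)
    define a where "a = (s + t) / 2"
    have a: "s < a" "a < t" using \<open>s < t\<close> by (auto simp: a_def)
    have "norm (w a) \<le> norm (w t)"
      using le_start[OF a(1)] ge by simp
    then have "(norm (w a))\<^sup>2 \<le> (norm (w t))\<^sup>2" by (simp add: power_mono)
    then have "(LBINT r:{a..t}. min 1 (m r)) \<le> 0"
      using energy[of a t] a dissipation(1)[of a t] by linarith
    then have "(LBINT r. indicat_real {a..t} r * min 1 (m r)) = 0"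
      using dissipation(2)[of a t] by (simp add: set_lebesgue_integral_def)
    moreover have "integrable lborel (\<lambda>r. indicat_real {a..t} r * min 1 (m r))"
      using m_int[of a t] by (simp add: set_integrable_def)
    ultimately have "AE r in lborel. indicat_real {a..t} r * min 1 (m r) = 0"
      using m_nonneg by (subst (asm) integral_nonneg_eq_0_iff_AE) (auto simp: indicator_def)
    then have "AE r in lborel. r \<notin> {a..t}"
      using wz
    proof eventually_elim
      case (elim r)
      show ?case
      proof
        assume r: "r \<in> {a..t}"
        then have "0 < norm (\<iota> (z r))"
          using elim(2) a antimono[of r t] pos by auto
        then have "0 < norm (\<iota> (z r))" "v1 r \<noteq> v2 r"
          by (auto simp: z_def v1_def v2_def \<iota>.zero)
        then have "0 < norm (v1 r) powr \<delta> + norm (v2 r) powr \<delta>"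
          by (cases "v1 r = 0") (auto intro: add_pos_nonneg)
        with \<open>0 < norm (\<iota> (z r))\<close> have "0 < m r"
          using c' unfolding m_def by (intro mult_pos_pos divide_pos_pos zero_less_power)
        then show False using elim(1) r by (simp add: min_def split: if_splits)
      qed
    qed
    then have "emeasure lborel {a..t} = 0"
      by (subst (asm) AE_iff_measurable[where N = "{a..t}"]) auto
    then show False using a by simp
  qed
qed

section \<open>Stationary random compact sets\<close>

lemma semidist_singleton_less_iff:
  "semidist {x} K < ennreal r \<longleftrightarrow> (\<exists>a\<in>K. dist x a < r)"
  by (simp add: semidist_def INF_less_iff ennreal_less_iff dist_norm)

text \<open>
  The diameter of a random set exceeds \<open>q\<close> exactly when two points of a countable dense set are close to
  it and sufficiently far from each other. This reduces the event to countably many conditions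
  on distances to the set.
\<close>

lemma sets_spread_greater:
  fixes K :: "'w \<Rightarrow> 'h::{real_normed_vector, second_countable_topology} set" and q :: real
  assumes [measurable]: "\<And>x. (\<lambda>\<omega>. semidist {x} (K \<omega>)) \<in> borel_measurable M"
  shows "{\<omega> \<in> space M. \<exists>a\<in>K \<omega>. \<exists>b\<in>K \<omega>. q < dist a b} \<in> sets M"
proof -
  obtain D :: "'h set" where D: "countable D" "\<And>X. open X \<Longrightarrow> X \<noteq> {} \<Longrightarrow> \<exists>d\<in>D. d \<in> X"
    by (erule countable_dense_setE)
  define I where "I = {(d, e, r). d \<in> D \<and> e \<in> D \<and> r \<in> \<rat> \<and> q + 2 * r < dist d e}"
  define N where "N = (\<lambda>(d, e, r). {\<omega> \<in> space M. semidist {d} (K \<omega>) < ennreal r \<and> semidist {e} (K \<omega>) < ennreal r})"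
  have "countable I"
    by (rule countable_subset[of _ "D \<times> D \<times> \<rat>"]) (auto simp: I_def D(1) countable_rat)
  moreover have "N i \<in> sets M" for i
    unfolding N_def by (cases i) simp
  ultimately have "(\<Union>i\<in>I. N i) \<in> sets M" by blast
  moreover have "(\<Union>i\<in>I. N i) = {\<omega> \<in> space M. \<exists>a\<in>K \<omega>. \<exists>b\<in>K \<omega>. q < dist a b}"
  proof (intro equalityI subsetI)
    fix \<omega> assume "\<omega> \<in> (\<Union>i\<in>I. N i)"
    then obtain d e r a b where "\<omega> \<in> space M" "q + 2 * r < dist d e"
      "a \<in> K \<omega>" "dist d a < r" "b \<in> K \<omega>" "dist e b < r"
      by (auto simp: I_def N_def semidist_singleton_less_iff)
    moreover from this have "q < dist a b"
      using dist_triangle[of d e a] dist_triangle[of a e b] by (simp add: dist_commute)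
    ultimately show "\<omega> \<in> {\<omega> \<in> space M. \<exists>a\<in>K \<omega>. \<exists>b\<in>K \<omega>. q < dist a b}" by blast
  next
    fix \<omega> assume "\<omega> \<in> {\<omega> \<in> space M. \<exists>a\<in>K \<omega>. \<exists>b\<in>K \<omega>. q < dist a b}"
    then obtain a b where \<omega>: "\<omega> \<in> space M" and ab: "a \<in> K \<omega>" "b \<in> K \<omega>" "q < dist a b" by blast
    obtain r where r: "r \<in> \<rat>" "0 < r" "r < (dist a b - q) / 4"
      using Rats_dense_in_real[of 0 "(dist a b - q) / 4"] ab(3) by auto
    obtain d where d: "d \<in> D" "dist d a < r"
      using D(2)[of "ball a r"] r(2) by (auto simp: dist_commute)
    obtain e where e: "e \<in> D" "dist e b < r"
      using D(2)[of "ball b r"] r(2) by (auto simp: dist_commute)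
    have "dist a b < dist d e + 2 * r"
      using dist_triangle[of a b d] dist_triangle[of d b e] d(2) e(2) by (simp add: dist_commute)
    then have "(d, e, r) \<in> I"
      using r d(1) e(1) by (simp add: I_def field_simps)
    moreover have "\<omega> \<in> N (d, e, r)"
      using \<omega> ab(1,2) d(2) e(2) by (auto simp: N_def semidist_singleton_less_iff)
    ultimately show "\<omega> \<in> (\<Union>i\<in>I. N i)" by blast
  qed
  ultimately show ?thesis by simp
qed

text \<open>The preimage of \<open>E\<close> contains \<open>E\<close> up to a null set and has the same finite measure.\<close>

lemma (in finite_measure) AE_invariant_event:
  assumes T: "T \<in> measurable M M" "distr M M T = M" and E: "E \<in> sets M"
    and sub: "AE \<omega> in M. \<omega> \<in> E \<longrightarrow> T \<omega> \<in> E"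
  shows "AE \<omega> in M. T \<omega> \<in> E \<longrightarrow> \<omega> \<in> E"
proof -
  define E' where "E' = T -` E \<inter> space M"
  have E': "E' \<in> sets M" using T(1) E by (auto simp: E'_def)
  have "measure M E' = measure M E"
    using measure_distr[OF T(1) E] T(2) by (simp add: E'_def)
  moreover have "measure M (E' \<inter> E) = measure M E"
  proof (rule measure_eq_AE)
    show "AE \<omega> in M. (\<omega> \<in> E' \<inter> E) = (\<omega> \<in> E)"
      using sub AE_space by eventually_elim (auto simp: E'_def)
  qed (use E E' in auto)
  ultimately have "measure M (E' - E) = 0"
    using finite_measure_Diff'[OF E' E] by simp
  then have "AE \<omega> in M. \<omega> \<notin> E' - E"
    using E E' by (intro AE_not_in) (auto simp: null_sets_def emeasure_eq_measure)
  then show ?thesis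
    using AE_space by eventually_elim (auto simp: E'_def)
qed

text \<open>
  Applied to the events that the diameter exceeds a rational number \<open>q\<close>, the previous lemma shows
  that the diameters of \<open>K \<omega>\<close> and \<open>K (T \<omega>)\<close> agree almost surely. A strictly contracting map of \<open>K (T \<omega>)\<close>
  onto \<open>K \<omega>\<close> must lose diameter unless \<open>K \<omega>\<close> has only one point: the pair of points at maximal
  distance, which exists by compactness, has preimages strictly farther apart.
\<close>

lemma (in prob_space) AE_singleton_if_stationary_strictly_contracted:
  fixes K :: "'a \<Rightarrow> 'h::{real_normed_vector, second_countable_topology} set"
  assumes T: "T \<in> measurable M M" "distr M M T = M"
    and K: "\<And>x. (\<lambda>\<omega>. semidist {x} (K \<omega>)) \<in> borel_measurable M"
    and compact: "AE \<omega> in M. K \<omega> \<noteq> {} \<and> compact (K \<omega>)"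
    and invariant: "AE \<omega> in M. K \<omega> = \<psi> \<omega> ` K (T \<omega>)"
    and contract: "AE \<omega> in M. \<forall>x y. x \<noteq> y \<longrightarrow> dist (\<psi> \<omega> x) (\<psi> \<omega> y) < dist x y"
  shows "AE \<omega> in M. \<exists>x. K \<omega> = {x}"
proof -
  define E where "E q = {\<omega> \<in> space M. \<exists>a\<in>K \<omega>. \<exists>b\<in>K \<omega>. q < dist a b}" for q
  have "AE \<omega> in M. T \<omega> \<in> E q \<longrightarrow> \<omega> \<in> E q" for q
  proof (rule AE_invariant_event[OF T])
    show "E q \<in> sets M"
      unfolding E_def by (rule sets_spread_greater[OF K])
    show "AE \<omega> in M. \<omega> \<in> E q \<longrightarrow> T \<omega> \<in> E q"
      using invariant contract AE_space
    proof (eventually_elim, intro impI)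
      fix \<omega>
      assume inv: "K \<omega> = \<psi> \<omega> ` K (T \<omega>)" and "\<omega> \<in> E q" and \<omega>: "\<omega> \<in> space M"
        and contr: "\<forall>x y. x \<noteq> y \<longrightarrow> dist (\<psi> \<omega> x) (\<psi> \<omega> y) < dist x y"
      then obtain a b where ab: "a \<in> K (T \<omega>)" "b \<in> K (T \<omega>)" "q < dist (\<psi> \<omega> a) (\<psi> \<omega> b)"
        by (auto simp: E_def)
      have "dist (\<psi> \<omega> a) (\<psi> \<omega> b) \<le> dist a b"
        using contr by (cases "a = b") (auto intro: less_imp_le)
      then have "q < dist a b" using ab(3) by simp
      then show "T \<omega> \<in> E q"
        using ab(1,2) measurable_space[OF T(1) \<omega>] by (auto simp: E_def)
    qed
  qed
  then have "AE \<omega> in M. \<forall>q\<in>\<rat>. T \<omega> \<in> E q \<longrightarrow> \<omega> \<in> E q"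
    by (simp add: AE_ball_countable countable_rat)
  then show ?thesis
    using invariant contract compact AE_space
  proof eventually_elim
    case (elim \<omega>)
    obtain a b where ab: "a \<in> K \<omega>" "b \<in> K \<omega>" "dist a b = diameter (K \<omega>)"
      using diameter_compact_attained elim(4) by blast
    have "a = b"
    proof (rule ccontr)
      assume "a \<noteq> b"
      obtain a' b' where ab': "a' \<in> K (T \<omega>)" "b' \<in> K (T \<omega>)" "a = \<psi> \<omega> a'" "b = \<psi> \<omega> b'"
        using ab(1,2) elim(2) by blast
      have "dist a b < dist a' b'"
        using elim(3) ab'(3,4) \<open>a \<noteq> b\<close> by metis
      then obtain q where q: "q \<in> \<rat>" "dist a b < q" "q < dist a' b'"
        using Rats_dense_in_real by blast
      then have "T \<omega> \<in> E q"
        using ab' measurable_space[OF T(1) elim(5)] by (auto simp: E_def)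
      then have "\<omega> \<in> E q" using elim(1) q(1) by blast
      then obtain c d where "c \<in> K \<omega>" "d \<in> K \<omega>" "q < dist c d"
        by (auto simp: E_def)
      moreover have "dist c d \<le> diameter (K \<omega>)" if "c \<in> K \<omega>" "d \<in> K \<omega>" for c d
        using diameter_bounded_bound[OF compact_imp_bounded] elim(4) that by blast
      ultimately show False using ab(3) q(2) by fastforce
    qed
    have "K \<omega> = {a}"
    proof -
      have "x = a" if "x \<in> K \<omega>" for x
        using diameter_bounded_bound[OF compact_imp_bounded, of "K \<omega>" x a] elim(4) that ab \<open>a = b\<close>
        by (metis dist_eq_0_iff dist_le_zero_iff)
      then show ?thesis using ab(1) by blast
    qed
    then show ?case by blast
  qed
qed

lemma borel_measurable_if_dist_measurable:
  fixes f :: "'a \<Rightarrow> 'b::{metric_space, second_countable_topology}"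
  assumes [measurable]: "\<And>x. (\<lambda>\<omega>. dist x (f \<omega>)) \<in> borel_measurable M"
  shows "f \<in> borel_measurable M"
proof (rule borel_measurableI)
  fix S :: "'b set" assume "open S"
  obtain D :: "'b set" where D: "countable D" "\<And>X. open X \<Longrightarrow> X \<noteq> {} \<Longrightarrow> \<exists>d\<in>D. d \<in> X"
    by (erule countable_dense_setE)
  define I where "I = {(d, r). d \<in> D \<and> r \<in> \<rat> \<and> ball d r \<subseteq> S}"
  have "countable I"
    by (rule countable_subset[of _ "D \<times> \<rat>"]) (auto simp: I_def D(1) countable_rat)
  then have "(\<Union>i\<in>I. {\<omega> \<in> space M. dist (fst i) (f \<omega>) < snd i}) \<in> sets M"
    by (intro sets.countable_UN'') measurable
  moreover have "(\<Union>i\<in>I. {\<omega> \<in> space M. dist (fst i) (f \<omega>) < snd i}) = f -` S \<inter> space M"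
  proof (intro equalityI subsetI)
    fix \<omega> assume "\<omega> \<in> f -` S \<inter> space M"
    then obtain e where e: "0 < e" "ball (f \<omega>) e \<subseteq> S" and \<omega>: "\<omega> \<in> space M"
      using \<open>open S\<close> by (auto simp: open_contains_ball)
    obtain r where r: "r \<in> \<rat>" "0 < r" "r < e / 2"
      using Rats_dense_in_real[of 0 "e / 2"] e(1) by auto
    obtain d where d: "d \<in> D" "dist d (f \<omega>) < r"
      using D(2)[of "ball (f \<omega>) r"] r(2) by (auto simp: dist_commute)
    have "ball d r \<subseteq> S"
    proof
      fix x assume "x \<in> ball d r"
      then have "dist (f \<omega>) x < e"
        using d(2) r(3) dist_triangle[of "f \<omega>" x d] by (simp add: dist_commute)
      then show "x \<in> S" using e(2) by auto
    qed
    then show "\<omega> \<in> (\<Union>i\<in>I. {\<omega> \<in> space M. dist (fst i) (f \<omega>) < snd i})"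
      using r d \<omega> by (auto simp: I_def intro!: bexI[of _ "(d, r)"])
  qed (auto simp: I_def)
  ultimately show "f -` S \<inter> space M \<in> sets M" by simp
qed

text \<open>
  On the event that \<open>K \<omega>\<close> is a singleton, the distance from \<open>x\<close> to its element is the distance from
  \<open>x\<close> to the set. This event is measurable: it says that the set is nonempty, that is, at finite
  distance from \<open>0\<close>, and that its diameter is not positive.
\<close>

lemma borel_measurable_singleton_element:
  fixes K :: "'w \<Rightarrow> 'h::{real_normed_vector, second_countable_topology} set"
  assumes [measurable]: "\<And>x. (\<lambda>\<omega>. semidist {x} (K \<omega>)) \<in> borel_measurable M"
  shows "(\<lambda>\<omega>. if \<exists>x. K \<omega> = {x} then the_elem (K \<omega>) else 0) \<in> borel_measurable M"
proof (rule borel_measurable_if_dist_measurable)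
  fix x :: 'h
  let ?E = "{\<omega> \<in> space M. \<exists>a\<in>K \<omega>. \<exists>b\<in>K \<omega>. 0 < dist a b}"
  have [measurable]: "?E \<in> sets M"
    by (rule sets_spread_greater) simp
  have singleton_iff: "(\<exists>x. K \<omega> = {x}) \<longleftrightarrow> semidist {0} (K \<omega>) < top \<and> \<omega> \<notin> ?E"
    if "\<omega> \<in> space M" for \<omega>
  proof -
    have "semidist {0} (K \<omega>) < top \<longleftrightarrow> K \<omega> \<noteq> {}"
      by (auto simp: semidist_def INF_less_iff)
    moreover have "(\<exists>x. K \<omega> = {x}) \<longleftrightarrow> K \<omega> \<noteq> {} \<and> (\<forall>a\<in>K \<omega>. \<forall>b\<in>K \<omega>. a = b)"
      by (metis (no_types, lifting) equals0I insertI1 insert_not_empty singletonD subsetI subset_antisym)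
    ultimately show ?thesis using that by auto
  qed
  have "(\<lambda>\<omega>. if semidist {0} (K \<omega>) < top \<and> \<omega> \<notin> ?E then enn2real (semidist {x} (K \<omega>)) else dist x 0)
          \<in> borel_measurable M"
    by measurable
  also have "?this \<longleftrightarrow> (\<lambda>\<omega>. dist x (if \<exists>x. K \<omega> = {x} then the_elem (K \<omega>) else 0)) \<in> borel_measurable M"
  proof (rule measurable_cong)
    fix \<omega> assume \<omega>: "\<omega> \<in> space M"
    show "(if semidist {0} (K \<omega>) < top \<and> \<omega> \<notin> ?E then enn2real (semidist {x} (K \<omega>)) else dist x 0)
        = dist x (if \<exists>x. K \<omega> = {x} then the_elem (K \<omega>) else 0)"
      unfolding singleton_iff[OF \<omega>, symmetric] by (auto simp: semidist_def dist_norm)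
  qed
  finally show "(\<lambda>\<omega>. dist x (if \<exists>x. K \<omega> = {x} then the_elem (K \<omega>) else 0)) \<in> borel_measurable M" .
qed

section \<open>The random fixed point\<close>

theorem corollary3p10:
  fixes M :: "'w measure"
    and F :: "real \<Rightarrow> 'w measure"
    and \<theta> :: "real \<Rightarrow> 'w \<Rightarrow> 'w"
    and \<iota> :: "'v::{banach, second_countable_topology}
               \<Rightarrow> 'h::{real_inner, banach, second_countable_topology}"
    and A :: "'v \<Rightarrow> ('v \<Rightarrow>\<^sub>L real)"
    and \<alpha> f c C2 :: real
    and N :: "real \<Rightarrow> 'w \<Rightarrow> 'v"
    and Z S :: "real \<Rightarrow> real \<Rightarrow> 'w \<Rightarrow> 'h \<Rightarrow> 'h"
    and \<phi> :: "real \<Rightarrow> 'w \<Rightarrow> 'h \<Rightarrow> 'h"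
    and Hp S0 :: "'h set"
    and Ab :: "real \<Rightarrow> 'w \<Rightarrow> 'h set"
  assumes "gelfand_triple \<iota>"
    and "metric_dynamical_system M \<theta>"
    and "filtered_space M F"
    and "drift_condition \<iota> A \<alpha> f c C2"
    and "noise_condition M F \<theta> \<alpha> N"
    and "solution_flow M \<iota> A \<alpha> N Z"
    and S_def: "S = stochastic_flow \<iota> N Z"
    and phi_def: "\<phi> = cocycle_of S"
    and "order_condition M \<phi> Hp S0"
    and "random_attractor M bounded_families S Ab"
    and "strictly_stationary M \<theta> Ab"
    and "measurable_family M Ab"
  shows "\<exists>\<eta> \<in> borel_measurable M. AE \<omega> in M.
           Ab 0 \<omega> = {\<eta> \<omega>} \<and> (\<forall>t\<ge>0. \<phi> t \<omega> (\<eta> \<omega>) = \<eta> (\<theta> t \<omega>))"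
proof -
  have "prob_space M" and \<theta>_joint: "(\<lambda>(t, \<omega>). \<theta> t \<omega>) \<in> measurable (borel \<Otimes>\<^sub>M M) M"
    and \<theta>_distr: "distr M M (\<theta> t) = M" for t
    using assms(2) by (auto simp: metric_dynamical_system_def)
  interpret prob_space M by fact
  have \<theta>_meas: "\<theta> t \<in> measurable M M" for t
    using measurable_compose[OF measurable_Pair1'[of t borel M] \<theta>_joint] by simp
  have compact: "AE \<omega> in M. \<forall>t. Ab t \<omega> \<noteq> {} \<and> compact (Ab t \<omega>)"
    and invariant: "AE \<omega> in M. \<forall>s t. s \<le> t \<longrightarrow> S t s \<omega> ` Ab s \<omega> = Ab t \<omega>"
    using \<open>random_attractor M bounded_families S Ab\<close> by (simp_all add: random_attractor_def)
  have stationary: "Ab t \<omega> = Ab 0 (\<theta> t \<omega>)" if "\<omega> \<in> space M" for t \<omega>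
    using \<open>strictly_stationary M \<theta> Ab\<close> that by (auto simp: strictly_stationary_def)
  have meas: "(\<lambda>\<omega>. semidist {x} (Ab 0 \<omega>)) \<in> borel_measurable M" for x
    using \<open>measurable_family M Ab\<close> by (auto simp: measurable_family_def)
  have "AE \<omega> in M. continuous_on UNIV (\<lambda>t. N t \<omega>)"
    using \<open>noise_condition M F \<theta> \<alpha> N\<close> by (simp add: noise_condition_def two_sided_wiener_def)
  then have contract: "AE \<omega> in M. \<forall>x y. x \<noteq> y \<longrightarrow> dist (S 0 (- 1) \<omega> x) (S 0 (- 1) \<omega> y) < dist x y"
    using AE_space
  proof (eventually_elim, intro allI impI)
    fix \<omega> and x y :: 'h
    assume N: "continuous_on UNIV (\<lambda>t. N t \<omega>)" and \<omega>: "\<omega> \<in> space M" and "x \<noteq> y"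
    have sol: "is_solution \<iota> A \<alpha> (\<lambda>r. N r \<omega>) (- 1) x (\<lambda>t. Z t (- 1) \<omega> x)" for x
      using \<open>solution_flow M \<iota> A \<alpha> N Z\<close> \<omega> by (simp add: solution_flow_def)
    show "dist (S 0 (- 1) \<omega> x) (S 0 (- 1) \<omega> y) < dist x y"
      using solutions_strictly_contract[OF assms(1,4) N sol[of "x - \<iota> (N (- 1) \<omega>)"]
          sol[of "y - \<iota> (N (- 1) \<omega>)"], of 0] \<open>x \<noteq> y\<close>
      by (simp add: S_def stochastic_flow_def dist_norm)
  qed
  have invariant': "AE \<omega> in M. Ab 0 \<omega> = S 0 (- 1) \<omega> ` Ab 0 (\<theta> (- 1) \<omega>)"
    using invariant AE_space
  proof eventually_elim
    case (elim \<omega>)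
    then have "S 0 (- 1) \<omega> ` Ab (- 1) \<omega> = Ab 0 \<omega>" by simp
    then show ?case using stationary[OF elim(2), of "- 1"] by simp
  qed
  have compact': "AE \<omega> in M. Ab 0 \<omega> \<noteq> {} \<and> compact (Ab 0 \<omega>)"
    using compact by eventually_elim blast
  have singleton: "AE \<omega> in M. \<exists>x. Ab 0 \<omega> = {x}"
    by (rule AE_singleton_if_stationary_strictly_contracted
        [OF \<theta>_meas \<theta>_distr meas compact' invariant' contract])
  define \<eta> where "\<eta> \<omega> = (if \<exists>x. Ab 0 \<omega> = {x} then the_elem (Ab 0 \<omega>) else 0)" for \<omega>
  have \<eta>_eq: "\<eta> \<omega> = x" if "Ab 0 \<omega> = {x}" for \<omega> x
    using that by (auto simp: \<eta>_def)
  have "\<eta> \<in> borel_measurable M"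
    unfolding \<eta>_def[abs_def] by (rule borel_measurable_singleton_element[OF meas])
  moreover have "AE \<omega> in M. Ab 0 \<omega> = {\<eta> \<omega>} \<and> (\<forall>t\<ge>0. \<phi> t \<omega> (\<eta> \<omega>) = \<eta> (\<theta> t \<omega>))"
    using singleton invariant AE_space
  proof eventually_elim
    case (elim \<omega>)
    have fixed: "Ab 0 \<omega> = {\<eta> \<omega>}"
      using elim(1) \<eta>_eq by blast
    have "\<phi> t \<omega> (\<eta> \<omega>) = \<eta> (\<theta> t \<omega>)" if "0 \<le> t" for t
    proof -
      have "S t 0 \<omega> ` Ab 0 \<omega> = Ab t \<omega>"
        using elim(2) that by blast
      \<comment> \<open>Thus \<open>Ab 0 (\<theta> t \<omega>)\<close> is a singleton for all \<open>t \<ge> 0\<close> at once, off a single null set.\<close>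
      then have "Ab 0 (\<theta> t \<omega>) = {S t 0 \<omega> (\<eta> \<omega>)}"
        using fixed stationary[OF elim(3), of t] by simp
      then show ?thesis
        using \<eta>_eq by (simp add: phi_def cocycle_of_def)
    qed
    with fixed show ?case by blast
  qed
  ultimately show ?thesis by blast
qed

end
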